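(* Let $k\ge 4$ and let $R$ be an arbitrary $k$-vertex tournament whose edges are colored with the $\binom k2$ distinct colors from $\binom{[k]}2$. Then $i(R)=\frac{k!}{k^k-k}$.
   Context: For an $s$-vertex tournament $H$ whose edges are colored from $\binom{[k]}2$, $i(R;H)$ denotes the number of copies of $R$ in $H$, i.e. the number of $k$-sets $K$ of vertices such that $H[K]$ is isomorphic to $R$ preserving orientations and colors. The inducibility of $R$ is $i(R)=\lim_{s\to\infty}\max_{|V(H)|=s} i(R;H)/\binom sk$, the maximum over all $s$-vertex $\binom{[k]}2$-edge-colored tournaments $H$. *)

theory Defs
  imports Complex_Main
begin

text \<open>Vertices of an n-vertex object are 0,...,n-1. A tournament is an arc relation T.
Edge colours are elements of binom([k],2), i.e. 2-subsets of {1..k}; a colouring assigns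
a colour to each unordered pair {u,v} (a 2-subset of the vertex set).\<close>

definition two_subsets :: "nat set \<Rightarrow> nat set set" where
  "two_subsets A = {e. e \<subseteq> A \<and> card e = 2}"

definition tournament :: "nat \<Rightarrow> (nat \<Rightarrow> nat \<Rightarrow> bool) \<Rightarrow> bool" where
  "tournament n T \<longleftrightarrow>
     (\<forall>u v. T u v \<longrightarrow> u < n \<and> v < n \<and> u \<noteq> v) \<and>
     (\<forall>u<n. \<forall>v<n. u \<noteq> v \<longrightarrow> T u v \<or> T v u) \<and>
     (\<forall>u v. T u v \<longrightarrow> \<not> T v u)"

definition edge_coloring :: "nat \<Rightarrow> nat \<Rightarrow> (nat set \<Rightarrow> nat set) \<Rightarrow> bool" where
  "edge_coloring k n col \<longleftrightarrow> (\<forall>e \<in> two_subsets {0..<n}. col e \<in> two_subsets {1..k})"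

definition is_copy ::
  "nat \<Rightarrow> (nat \<Rightarrow> nat \<Rightarrow> bool) \<Rightarrow> (nat set \<Rightarrow> nat set) \<Rightarrow>
   (nat \<Rightarrow> nat \<Rightarrow> bool) \<Rightarrow> (nat set \<Rightarrow> nat set) \<Rightarrow> nat set \<Rightarrow> bool" where
  "is_copy k TR colR T col K \<longleftrightarrow>
     (\<exists>f. bij_betw f {0..<k} K \<and>
          (\<forall>i<k. \<forall>j<k. i \<noteq> j \<longrightarrow>
              (T (f i) (f j) \<longleftrightarrow> TR i j) \<and> col {f i, f j} = colR {i, j}))"

definition num_copies ::
  "nat \<Rightarrow> (nat \<Rightarrow> nat \<Rightarrow> bool) \<Rightarrow> (nat set \<Rightarrow> nat set) \<Rightarrow>
   nat \<Rightarrow> (nat \<Rightarrow> nat \<Rightarrow> bool) \<Rightarrow> (nat set \<Rightarrow> nat set) \<Rightarrow> nat" where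
  "num_copies k TR colR s T col =
     card {K. K \<subseteq> {0..<s} \<and> card K = k \<and> is_copy k TR colR T col K}"

definition max_copies ::
  "nat \<Rightarrow> (nat \<Rightarrow> nat \<Rightarrow> bool) \<Rightarrow> (nat set \<Rightarrow> nat set) \<Rightarrow> nat \<Rightarrow> nat" where
  "max_copies k TR colR s =
     Max {num_copies k TR colR s T col | T col. tournament s T \<and> edge_coloring k s col}"

end

theory Submission
  imports Defs "HOL-Analysis.Analysis" "HOL-Real_Asymp.Real_Asymp"
begin

text \<open>Since all colours of \<open>R\<close> are distinct, the colour and direction of an edge \<open>uv\<close> of \<open>H\<close> say
which vertex of \<open>R\<close> is to be played by \<open>u\<close> and which by \<open>v\<close>; so \<open>H\<close> is a function \<open>a u v\<close> giving
the role of \<open>u\<close> on \<open>uv\<close>, and a copy is a tuple \<open>f\<close> with \<open>a (f i) (f j) = i\<close> for \<open>i \<noteq> j\<close>.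

Upper bound: by induction on the number \<open>s\<close> of vertices the number of copies is at most
\<open>s\<^sup>k / (k\<^sup>k - k) + O(s\<^sup>k\<^sup>-\<^sup>1)\<close>. In a maximal counterexample cloning shows that every vertex \<open>u\<close> lies
in many copies. As the copies in which \<open>u\<close> plays \<open>i\<close> live inside \<open>{w. a u w = i}\<close>, one of these
classes, that of the dominant role \<open>r u\<close>, has about \<open>(1 - 1/k) s\<close> elements. Partition the vertices
by dominant role; counting the copies at the vertices of each part shows that the parts
are nearly balanced. Call a pair in different parts bad if its roles are not the dominant
ones. A copy without bad pairs is a transversal of the partition or lies inside one part. A copy with a
bad pair has at least \<open>k - 2\<close> of them, each in few copies, and double counting shows that there
are no more such copies than transversals with a bad pair; this is where \<open>k \<ge> 4\<close> enters. So the number of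
copies is at most the product of the part sizes plus the copies inside the parts,
and the induction closes by AM-GM.

Lower bound: the iterated balanced blow-up, obtained by giving \<open>u\<close> and \<open>v\<close> as roles their least
significant base-\<open>k\<close> digits at which they differ.\<close>

section \<open>Inequalities\<close>

lemma prod_le_mean_power:
  fixes x :: "'a \<Rightarrow> real"
  assumes "finite S" "S \<noteq> {}" "\<And>i. i \<in> S \<Longrightarrow> x i \<ge> 0"
  shows "(\<Prod>i\<in>S. x i) \<le> ((\<Sum>i\<in>S. x i) / card S) ^ card S"
proof -
  let ?P = "\<Prod>i\<in>S. x i" and ?n = "card S"
  have n: "?n > 0" using assms by (simp add: card_gt_0_iff)
  have P: "?P \<ge> 0" by (simp add: assms(3) prod_nonneg)
  have "(?P powr (1 / ?n)) ^ ?n = ?P"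
    using P n by (cases "?P = 0") (simp_all add: powr_realpow [symmetric] powr_powr)
  moreover have "?P powr (1 / ?n) \<le> (\<Sum>i\<in>S. x i) / ?n"
    using arith_geom_mean[OF assms] by (simp add: sum_divide_distrib)
  ultimately show ?thesis by (metis power_mono powr_ge_zero)
qed

lemma sum_power_le_power_sum:
  fixes x :: "'a \<Rightarrow> real"
  assumes "finite S" "\<And>i. i \<in> S \<Longrightarrow> x i \<ge> 0" "n \<ge> 1"
  shows "(\<Sum>i\<in>S. x i ^ n) \<le> (\<Sum>i\<in>S. x i) ^ n"
proof -
  obtain n' where n': "n = Suc n'" using assms(3) by (cases n) auto
  have "(\<Sum>i\<in>S. x i ^ n) \<le> (\<Sum>i\<in>S. x i * (\<Sum>i\<in>S. x i) ^ n')"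
    unfolding n' power_Suc
    by (intro sum_mono mult_left_mono power_mono member_le_sum) (use assms in auto)
  also have "\<dots> = (\<Sum>i\<in>S. x i) ^ n" by (simp add: n' sum_distrib_right)
  finally show ?thesis .
qed

text \<open>The power \<open>x^m\<close> is convex on the nonnegative reals, and \<open>x\<close>
  and \<open>1 - x\<close> are convex combinations of \<open>z\<close> and \<open>1 - z\<close> with
  swapped weights. The case \<open>z = 1/2\<close>, where \<open>t\<close> would have denominator 0,
  is split off.\<close>

lemma power_sum_le_power_sum_spread:
  fixes x z :: real
  assumes "0 \<le> z" "z \<le> x" "x \<le> 1 - z"
  shows "x ^ m + (1 - x) ^ m \<le> (1 - z) ^ m + z ^ m"
proof (cases "1 - z = z")
  case True
  with assms have "x = z" by linarith
  then show ?thesis by simp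
next
  case False
  define t where "t = (x - z) / (1 - 2 * z)"
  have z: "1 - 2 * z > 0" using assms False by linarith
  have t: "0 \<le> t" "t \<le> 1" using assms z by (auto simp: t_def field_simps)
  have tz: "t * (1 - 2 * z) = x - z" using z by (simp add: t_def)
  have x: "x = (1 - t) *\<^sub>R z + t *\<^sub>R (1 - z)" "1 - x = (1 - t) *\<^sub>R (1 - z) + t *\<^sub>R z"
    using tz by (simp_all add: algebra_simps)
  have c: "convex_on {0::real..} (\<lambda>x. x ^ m)"
  proof (cases "even m")
    case True
    show ?thesis by (rule convex_on_subset[OF convex_power_even[OF True]]) auto
  qed (rule convex_power_odd)
  have "x ^ m \<le> (1 - t) * z ^ m + t * (1 - z) ^ m"
    by (subst x(1), rule convex_onD[OF c]) (use t assms in auto)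
  moreover have "(1 - x) ^ m \<le> (1 - t) * (1 - z) ^ m + t * z ^ m"
    by (subst x(2), rule convex_onD[OF c]) (use t assms in auto)
  ultimately show ?thesis by (simp add: algebra_simps)
qed

text \<open>Expanding \<open>(\<Sum>i<k. x i) ^ k\<close> gives one monomial for each \<open>g : {..<k} \<rightarrow> {..<k}\<close>. The monomials of
  the nonconstant \<open>g\<close> have geometric mean \<open>\<Prod>i<k. x i\<close>, so AM-GM applies, in the form \<open>1 + ln t \<le> t\<close>.\<close>

lemma power_diff_sum_ge_prod:
  fixes x :: "nat \<Rightarrow> real"
  assumes "k \<ge> 1" "\<And>i. i < k \<Longrightarrow> x i > 0"
  shows "(real k ^ k - real k) * (\<Prod>i<k. x i) + (\<Sum>i<k. x i ^ k) \<le> (\<Sum>i<k. x i) ^ k"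
proof -
  define A where "A = ({..<k} \<rightarrow>\<^sub>E {..<k})"
  define Cn where "Cn = (\<lambda>i. \<lambda>j\<in>{..<k}. i) ` {..<k}"
  define L where "L = (\<Sum>i<k. ln (x i))"
  define P where "P = (\<Prod>i<k. x i)"
  have finA: "finite A" by (simp add: A_def finite_PiE)
  have CA: "Cn \<subseteq> A" by (auto simp: Cn_def A_def split: if_splits)
  have inj: "inj_on (\<lambda>i. \<lambda>j\<in>{..<k}. i) {..<k}"
    using assms(1) by (intro inj_onI) (metis lessThan_iff less_le_trans restrict_apply' zero_less_one)
  have P: "P > 0" using assms(2) by (auto simp: P_def intro!: prod_pos)
  have lnP: "ln P = L" unfolding P_def L_def by (rule ln_prod) (use assms(2) in force)+
  have pos: "(\<Prod>j<k. x (g j)) > 0" if "g \<in> A" for g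
    using that assms(2) by (intro prod_pos) (auto simp: A_def)
  have tangent: "(\<Prod>j<k. x (g j)) / P \<ge> 1 + ((\<Sum>j<k. ln (x (g j))) - L)" if "g \<in> A" for g
  proof -
    have "x (g j) > 0" if "j < k" for j using that \<open>g \<in> A\<close> assms(2) by (auto simp: A_def)
    then have "ln ((\<Prod>j<k. x (g j)) / P) = (\<Sum>j<k. ln (x (g j))) - L"
      using pos[OF that] P lnP ln_prod[of "{..<k}" "\<lambda>j. x (g j)"] by (force simp: ln_div)
    moreover have "ln ((\<Prod>j<k. x (g j)) / P) \<le> (\<Prod>j<k. x (g j)) / P - 1"
      using pos[OF that] P by (intro ln_le_minus_one) auto
    ultimately show ?thesis by linarith
  qed
  have coord: "(\<Sum>g\<in>A. ln (x (g j))) = real k ^ (k - 1) * L" if "j < k" for j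
  proof -
    \<comment> \<open>A factor 1 at every coordinate other than \<open>j\<close> makes the summand a
      product over coordinates, so the sum over all \<open>g\<close> factorises.\<close>
    have "(\<Sum>g\<in>A. ln (x (g j))) = (\<Sum>g\<in>A. \<Prod>l<k. if l = j then ln (x (g l)) else 1)"
      using that by (intro sum.cong refl) (simp add: prod.delta)
    also have "\<dots> = (\<Prod>l<k. \<Sum>i<k. if l = j then ln (x i) else 1)"
      unfolding A_def by (subst prod_sum_PiE) auto
    also have "\<dots> = (\<Prod>l<k. if l = j then L else real k)"
      by (intro prod.cong) (auto simp: L_def)
    also have "\<dots> = L * (\<Prod>l\<in>{..<k}-{j}. real k)"
      using that by (subst prod.remove[of _ j]) (auto intro!: prod.cong)
    finally show ?thesis using that by (simp add: mult.commute)
  qed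
  have all: "(\<Sum>g\<in>A. \<Sum>j<k. ln (x (g j))) = real k ^ k * L"
    using assms(1) power_minus_mult[of k "real k"]
    by (subst sum.swap) (simp add: coord mult.assoc[symmetric] mult.commute)
  have const: "(\<Sum>g\<in>Cn. \<Sum>j<k. ln (x (g j))) = real k * L"
    unfolding Cn_def by (subst sum.reindex[OF inj]) (simp add: L_def sum_distrib_left)
  have cardA: "card A = k ^ k" by (simp add: A_def card_PiE)
  have cardC: "card Cn = k" unfolding Cn_def by (subst card_image[OF inj]) simp
  have cardD: "real (card (A - Cn)) = real k ^ k - real k"
    using CA finA cardA cardC card_mono[OF finA CA]
    by (simp add: card_Diff_subset finite_subset of_nat_diff)
  \<comment> \<open>The sum of logarithms averages to \<open>L\<close> over \<open>A\<close> and
    over \<open>Cn\<close>, so the logarithmic terms cancel over \<open>A - Cn\<close>.\<close>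
  have "real k ^ k - real k = (\<Sum>g\<in>A - Cn. 1 + ((\<Sum>j<k. ln (x (g j))) - L))"
  proof -
    have "(\<Sum>g\<in>A - Cn. \<Sum>j<k. ln (x (g j))) = (real k ^ k - real k) * L"
      using all const CA finA by (simp add: sum_diff left_diff_distrib)
    then show ?thesis by (simp add: sum.distrib sum_subtractf cardD)
  qed
  also have "\<dots> \<le> (\<Sum>g\<in>A - Cn. (\<Prod>j<k. x (g j)) / P)"
    by (intro sum_mono tangent) auto
  also have "\<dots> = ((\<Sum>g\<in>A. \<Prod>j<k. x (g j)) - (\<Sum>g\<in>Cn. \<Prod>j<k. x (g j))) / P"
    using CA finA by (simp add: sum_diff diff_divide_distrib sum_divide_distrib)
  also have "(\<Sum>g\<in>A. \<Prod>j<k. x (g j)) = (\<Sum>i<k. x i) ^ k"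
    unfolding A_def by (subst prod_sum_PiE[symmetric]) auto
  also have "(\<Sum>g\<in>Cn. \<Prod>j<k. x (g j)) = (\<Sum>i<k. x i ^ k)"
    unfolding Cn_def by (subst sum.reindex[OF inj]) simp
  finally show ?thesis using P unfolding P_def[symmetric] by (simp add: pos_le_divide_eq)
qed

text \<open>Pass to the shares \<open>y i\<close>. If no share exceeded \<open>1/2\<close>, the sum
  of their \<open>m\<close>-th powers would be at most \<open>(1/2)^(m - 1)\<close>; if the shares
  other than the largest added up to more than \<open>z\<close>, convexity would bound it by
  \<open>(1 - z)^m + z^m\<close>. Both lie below \<open>\<theta>\<close>.\<close>

lemma dominant_index:
  fixes x :: "nat \<Rightarrow> real"
  assumes x0: "\<And>i. i < k \<Longrightarrow> 0 \<le> x i" and sum: "(\<Sum>i<k. x i) \<le> s"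
    and "s > 0" "k \<ge> 1" "m \<ge> 1" "0 \<le> z" "z \<le> 1/2"
    and half: "(1/2) ^ (m - 1) < \<theta>" and spread: "(1 - z) ^ m + z ^ m < \<theta>"
    and large: "\<theta> * s ^ m \<le> (\<Sum>i<k. x i ^ m)"
  shows "\<exists>r<k. (\<Sum>i\<in>{..<k}-{r}. x i) \<le> z * s"
proof -
  define y where "y = (\<lambda>i. x i / s)"
  have y0: "0 \<le> y i" if "i < k" for i using x0[OF that] \<open>s > 0\<close> by (simp add: y_def)
  have ysum: "(\<Sum>i<k. y i) \<le> 1"
    using sum \<open>s > 0\<close> by (simp add: y_def flip: sum_divide_distrib)
  have ylarge: "\<theta> \<le> (\<Sum>i<k. y i ^ m)"
    using large \<open>s > 0\<close> by (simp add: y_def power_divide field_simps flip: sum_divide_distrib)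
  have "Max (y ` {..<k}) \<in> y ` {..<k}"
    using \<open>k \<ge> 1\<close> by (intro Max_in) (auto simp: lessThan_empty_iff)
  then obtain r where r: "r < k" "y r = Max (y ` {..<k})" by auto
  have ymax: "y i \<le> y r" if "i < k" for i using that r by simp
  have split: "(\<Sum>i<k. y i) = y r + (\<Sum>i\<in>{..<k}-{r}. y i)"
    using r by (intro sum.remove) auto
  have big: "y r > 1/2"
  proof (rule ccontr)
    assume "\<not> y r > 1/2"
    then have y2: "y i \<le> 1/2" if "i < k" for i using ymax[OF that] by linarith
    have "(\<Sum>i<k. y i ^ m) \<le> (\<Sum>i<k. y i * (1/2) ^ (m - 1))"
    proof (intro sum_mono)
      fix i assume "i \<in> {..<k}"
      then have "y i * y i ^ (m - 1) \<le> y i * (1/2) ^ (m - 1)"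
        by (intro mult_left_mono power_mono) (use y0 y2 in auto)
      then show "y i ^ m \<le> y i * (1/2) ^ (m - 1)" using \<open>m \<ge> 1\<close> power_minus_mult[of m "y i"] by (simp add: mult.commute)
    qed
    also have "\<dots> = (\<Sum>i<k. y i) * (1/2) ^ (m - 1)" by (simp add: sum_distrib_right)
    also have "\<dots> \<le> 1 * (1/2) ^ (m - 1)" by (intro mult_right_mono ysum) auto
    finally show False using ylarge half by simp
  qed
  have "(\<Sum>i\<in>{..<k}-{r}. y i) \<le> z"
  proof (rule ccontr)
    assume "\<not> ?thesis"
    then have yr: "y r \<le> 1 - z" using ysum split by linarith
    have "(\<Sum>i<k. y i ^ m) = y r ^ m + (\<Sum>i\<in>{..<k}-{r}. y i ^ m)"
      using r by (intro sum.remove) auto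
    also have "(\<Sum>i\<in>{..<k}-{r}. y i ^ m) \<le> (\<Sum>i\<in>{..<k}-{r}. y i) ^ m"
      using y0 \<open>m \<ge> 1\<close> by (intro sum_power_le_power_sum) auto
    also have "\<dots> \<le> (1 - y r) ^ m"
      using ysum split y0 by (intro power_mono sum_nonneg) auto
    also have "y r ^ m + (1 - y r) ^ m \<le> (1 - z) ^ m + z ^ m"
      using yr big \<open>0 \<le> z\<close> \<open>z \<le> 1/2\<close> by (intro power_sum_le_power_sum_spread) auto
    finally show False using spread ylarge by linarith
  qed
  then show ?thesis
    using r \<open>s > 0\<close> by (intro exI[of _ r]) (simp add: y_def field_simps flip: sum_divide_distrib)
qed

text \<open>The constant \<open>26/25\<close> allows the classes of the nondominant roles slightly more than their ideal
  total size \<open>s/k\<close>. It is chosen for \<open>k = 4\<close>, where the inequality of \<open>numeric_eps(2)\<close> reads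
  \<open>3.2448 \<le> 3.3334\<close>.\<close>

lemma numeric_spread:
  assumes "k \<ge> 4"
  shows "(1 - 26/(25 * real k)) ^ (k - 1) + (26/(25 * real k)) ^ (k - 1)
           < real (k - 1) ^ (k - 1) / (real k ^ (k - 1) - 1)"
proof (cases "k = 4")
  case True
  show ?thesis by (simp add: True power3_eq_cube eval_nat_numeral)
next
  case False
  define m where "m = k - 1"
  have m: "m \<ge> 4" "real k = real m + 1" using assms False by (auto simp: m_def)
  have km: "real k ^ m > 1" using assms m by (intro one_less_power) auto
  \<comment> \<open>Factoring out \<open>(m/k)^m\<close> leaves
    \<open>(1 - 1/(25*m))^m + (26/(25*m))^m\<close>, whose summands are at most \<open>25/26\<close>
    (by Bernoulli) and \<open>1/26\<close>. The second bound fails at \<open>m = 3\<close>, hence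
    the separate case \<open>k = 4\<close>.\<close>
  have b: "(1 - 1/(25 * real m)) ^ m * (26/25) \<le> 1"
  proof -
    have "(26/25::real) \<le> (1 + 1/(25 * real m)) ^ m"
      using Bernoulli_inequality[of "1/(25 * real m)" m] m
      by (simp add: order_trans[of _ 0])
    then have "(1 - 1/(25 * real m)) ^ m * (26/25) \<le> (1 - 1/(25 * real m)) ^ m * (1 + 1/(25 * real m)) ^ m"
      using m by (intro mult_left_mono zero_le_power) (auto simp: field_simps)
    also have "\<dots> = (1 - (1/(25 * real m))\<^sup>2) ^ m"
      by (simp add: power2_eq_square algebra_simps flip: power_mult_distrib)
    also have "\<dots> \<le> 1" using m by (intro power_le_one) (auto simp: power_le_one)
    finally show ?thesis .
  qed
  have "(26/(25 * real m)) ^ m \<le> (26/100) ^ m"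
    using m by (intro power_mono) (auto simp: field_simps)
  also have "\<dots> \<le> (26/100) ^ 4" using m by (intro power_decreasing) auto
  also have "\<dots> \<le> 1/26" by (simp add: eval_nat_numeral)
  finally have e: "(26/(25 * real m)) ^ m \<le> 1/26" .
  have eq1: "1 - 26/(25 * real k) = (real m / real k) * (1 - 1/(25 * real m))"
    using m by (simp add: divide_simps)
  have eq2: "26/(25 * real k) = (real m / real k) * (26/(25 * real m))"
    using m by (simp add: divide_simps)
  have pow1: "(1 - 26/(25 * real k)) ^ m = (real m / real k) ^ m * (1 - 1/(25 * real m)) ^ m"
    by (simp only: eq1 power_mult_distrib)
  have pow2: "(26/(25 * real k)) ^ m = (real m / real k) ^ m * (26/(25 * real m)) ^ m"
    by (simp only: eq2 power_mult_distrib)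
  have "(1 - 26/(25 * real k)) ^ m + (26/(25 * real k)) ^ m
      = (real m / real k) ^ m * ((1 - 1/(25 * real m)) ^ m + (26/(25 * real m)) ^ m)"
    by (simp only: pow1 pow2 distrib_left)
  also have "\<dots> \<le> (real m / real k) ^ m * 1"
    using b e by (intro mult_left_mono) auto
  also have "\<dots> = real m ^ m / real k ^ m" by (simp add: power_divide)
  also have "\<dots> < real m ^ m / (real k ^ m - 1)"
    using km m by (intro divide_strict_left_mono) auto
  finally show ?thesis by (simp add: m_def)
qed

text \<open>The right side exceeds \<open>((k - 1)/k)^(k - 1)\<close>, which is at least
  \<open>(3/4)^(k - 1)\<close>. Together with \<open>numeric_spread\<close> this supplies the
  numerical hypotheses of \<open>dominant_index\<close>.\<close>

lemma numeric_half:
  assumes "k \<ge> 4"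
  shows "(1/2) ^ (k - 1 - 1) < real (k - 1) ^ (k - 1) / (real k ^ (k - 1) - 1)"
proof -
  define m where "m = k - 1"
  have m: "m \<ge> 3" "real k = real m + 1" using assms by (auto simp: m_def)
  have km: "real k ^ m > 1" using assms m by (intro one_less_power) auto
  have "(2::real) \<le> (3/2) ^ 2" by (simp add: power2_eq_square)
  also have "\<dots> \<le> (3/2) ^ m" using m by (intro power_increasing) auto
  finally have "2 * (1/2) ^ m \<le> (3/2) ^ m * (1/2::real) ^ m" by (intro mult_right_mono) auto
  also have "\<dots> = (3/4) ^ m" by (simp flip: power_mult_distrib)
  also have "\<dots> \<le> (real m / real k) ^ m" using m by (intro power_mono) (auto simp: field_simps)
  also have "\<dots> = real m ^ m / real k ^ m" by (simp add: power_divide)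
  also have "\<dots> < real m ^ m / (real k ^ m - 1)"
    using km m by (intro divide_strict_left_mono) auto
  also have "2 * (1/2) ^ m = (1/2::real) ^ (m - 1)" using m power_minus_mult[of m "1/2::real"] by simp
  finally show ?thesis by (simp add: m_def)
qed

text \<open>In an \<open>s\<close>-vertex structure, \<open>\<epsilon> * (s/k)^(k - 1)\<close> will
  bound the copies in which a given vertex plays a nondominant role. The first inequality keeps the
  parts nonempty and smaller than the whole; the second is the hypothesis \<open>ineq\<close> of the
  double counting, divided by \<open>(s/k)^(k - 2)\<close>.\<close>

lemma numeric_eps:
  assumes "k \<ge> 4"
  defines "\<epsilon> \<equiv> (26/(25 * real (k - 1))) ^ (k - 1)"
  shows "real k * \<epsilon> \<le> 1/5"
    and "(26/(25 * real (k - 2))) ^ (k - 2) * (real k * real (k - 1))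
           \<le> 2 * real (k - 2) * (1 - real k * \<epsilon>)"
proof -
  have "real k * \<epsilon> \<le> 1/5 \<and> (26/(25 * real (k - 2))) ^ (k - 2) * (real k * real (k - 1))
           \<le> 2 * real (k - 2) * (1 - real k * \<epsilon>)"
  proof (cases "k = 4")
    case True
    show ?thesis by (simp add: True \<epsilon>_def eval_nat_numeral)
  next
    case False
    then have k: "k \<ge> 5" using assms by simp
    \<comment> \<open>The factor \<open>k\<close> is absorbed into a power of 2; what remains are
      powers of numbers below 1, largest at \<open>k = 5\<close>.\<close>
    have "\<epsilon> \<le> (26/100) ^ (k - 1)"
      unfolding \<epsilon>_def using k by (intro power_mono) (auto simp: field_simps)
    then have "real k * \<epsilon> \<le> 2 ^ k * (26/100) ^ (k - 1)"
      using less_exp[of k] by (intro mult_mono) (auto simp: \<epsilon>_def numeral_power_le_of_nat_cancel_iff)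
    also have "\<dots> = 2 * (2 * (26/100)) ^ (k - 1)"
      unfolding power_mult_distrib using k power_minus_mult[of k "2::real"] by simp
    also have "\<dots> = 2 * (52/100) ^ (k - 1)" by simp
    also have "\<dots> \<le> 2 * (52/100) ^ 4" using k by (intro mult_left_mono power_decreasing) auto
    also have "\<dots> \<le> 1/5" by (simp add: eval_nat_numeral)
    finally have e: "real k * \<epsilon> \<le> 1/5" .
    have k2: "k \<le> 2 ^ (k - 2)"
      using k
    proof (induction k rule: dec_induct)
      case (step n)
      then show ?case using power_minus_mult[of "n - 1" "2::nat"] by (simp add: numeral_2_eq_2)
    qed simp
    have "(26/(25 * real (k - 2))) ^ (k - 2) * real k \<le> (26/75) ^ (k - 2) * 2 ^ (k - 2)"
      using k k2 by (intro mult_mono power_mono) (auto simp: field_simps)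
    also have "\<dots> = (52/75) ^ (k - 2)" by (simp flip: power_mult_distrib)
    also have "\<dots> \<le> (52/75) ^ 3" using k by (intro power_decreasing) auto
    also have "\<dots> \<le> 2/5" by (simp add: eval_nat_numeral)
    finally have "(26/(25 * real (k - 2))) ^ (k - 2) * real k * real (k - 1) \<le> 2/5 * (2 * real (k - 2))"
      using k by (intro mult_mono) auto
    also have "\<dots> \<le> 2 * real (k - 2) * (1 - real k * \<epsilon>)"
      using e by (subst mult.commute, intro mult_left_mono) auto
    finally show ?thesis using e by (simp add: mult_ac)
  qed
  then show "real k * \<epsilon> \<le> 1/5"
    and "(26/(25 * real (k - 2))) ^ (k - 2) * (real k * real (k - 1))
           \<le> 2 * real (k - 2) * (1 - real k * \<epsilon>)" by auto
qed

section \<open>Copies in terms of roles\<close>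

text \<open>A copy is recorded as the tuple of its vertices in order of role. \<open>a\<close>
  ranges over all functions, a class closed under cloning; a value \<open>\<ge> k\<close> keeps an
  edge out of every copy.\<close>

definition copies :: "nat \<Rightarrow> 'a set \<Rightarrow> ('a \<Rightarrow> 'a \<Rightarrow> nat) \<Rightarrow> (nat \<Rightarrow> 'a) set" where
  "copies k V a = {f \<in> {..<k} \<rightarrow>\<^sub>E V. \<forall>i<k. \<forall>j<k. i \<noteq> j \<longrightarrow> a (f i) (f j) = i}"

lemma copies_role: "f \<in> copies k V a \<Longrightarrow> i < k \<Longrightarrow> j < k \<Longrightarrow> i \<noteq> j \<Longrightarrow> a (f i) (f j) = i"
  by (simp add: copies_def)

lemma copies_mem: "f \<in> copies k V a \<Longrightarrow> i < k \<Longrightarrow> f i \<in> V"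
  by (auto simp: copies_def)

lemma copies_undefined: "f \<in> copies k V a \<Longrightarrow> \<not> i < k \<Longrightarrow> f i = undefined"
  by (auto simp: copies_def PiE_def extensional_def)

text \<open>If \<open>f i = f j\<close> with \<open>i \<noteq> j\<close>, then
  \<open>a (f i) (f i)\<close> would equal both \<open>i\<close> and \<open>j\<close>.\<close>

lemma copies_inj: "f \<in> copies k V a \<Longrightarrow> i < k \<Longrightarrow> j < k \<Longrightarrow> f i = f j \<longleftrightarrow> i = j"
  by (cases "i = j") (use copies_role[of f k V a i j] copies_role[of f k V a j i] in auto)

lemma finite_copies: "finite V \<Longrightarrow> finite (copies k V a)"
  unfolding copies_def by (rule finite_subset[OF _ finite_PiE[of "{..<k}" "\<lambda>_. V"]]) auto

lemma card_copies_le: "finite V \<Longrightarrow> card (copies k V a) \<le> card V ^ k"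
proof -
  assume "finite V"
  then have "card (copies k V a) \<le> card ({..<k} \<rightarrow>\<^sub>E V)"
    by (intro card_mono finite_PiE) (simp_all add: copies_def subset_eq)
  then show ?thesis by (simp add: card_PiE)
qed

text \<open>\<open>J\<close> holds the free positions: the members of \<open>F\<close> agree
  elsewhere, so restriction to \<open>J\<close> is injective on \<open>F\<close>.\<close>

lemma card_le_prod_card:
  assumes "finite J" "\<And>j. j \<in> J \<Longrightarrow> finite (B j)"
    and "\<And>f j. f \<in> F \<Longrightarrow> j \<in> J \<Longrightarrow> f j \<in> B j"
    and "\<And>f g x. f \<in> F \<Longrightarrow> g \<in> F \<Longrightarrow> x \<notin> J \<Longrightarrow> f x = g x"
  shows "card F \<le> (\<Prod>j\<in>J. card (B j))"
proof -
  have "inj_on (\<lambda>f. restrict f J) F"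
  proof (intro inj_onI ext)
    fix f g x assume "f \<in> F" "g \<in> F" "restrict f J = restrict g J"
    then show "f x = g x" using assms(4) by (metis restrict_apply')
  qed
  moreover have "(\<lambda>f. restrict f J) ` F \<subseteq> PiE J B" using assms(3) by auto
  ultimately have "card F \<le> card (PiE J B)"
    using assms(1,2) by (intro card_inj_on_le) (auto intro: finite_PiE)
  then show ?thesis using assms(1) by (simp add: card_PiE)
qed

text \<open>Since \<open>c\<close> reads off the position of a vertex, the candidates for different
  free positions form disjoint subsets of \<open>A\<close>, and AM-GM bounds the product of their
  sizes.\<close>

lemma card_le_mean_power:
  assumes "finite A" "finite J" "J \<noteq> {}"
    and "\<And>f j. f \<in> F \<Longrightarrow> j \<in> J \<Longrightarrow> f j \<in> A \<and> c (f j) = j"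
    and "\<And>f g x. f \<in> F \<Longrightarrow> g \<in> F \<Longrightarrow> x \<notin> J \<Longrightarrow> f x = g x"
  shows "real (card F) \<le> (real (card A) / real (card J)) ^ card J"
proof -
  let ?B = "\<lambda>j. {w \<in> A. c w = j}"
  have "card F \<le> (\<Prod>j\<in>J. card (?B j))"
    using assms by (intro card_le_prod_card) auto
  then have "real (card F) \<le> (\<Prod>j\<in>J. real (card (?B j)))"
    by (metis of_nat_le_iff of_nat_prod)
  also have "\<dots> \<le> ((\<Sum>j\<in>J. real (card (?B j))) / real (card J)) ^ card J"
    using assms by (intro prod_le_mean_power) auto
  also have "(\<Sum>j\<in>J. card (?B j)) = card (\<Union>j\<in>J. ?B j)"
    using assms by (subst card_UN_disjoint) auto
  then have "(\<Sum>j\<in>J. real (card (?B j))) \<le> real (card A)"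
    using assms card_mono[of A "\<Union>j\<in>J. ?B j"] by (auto simp flip: of_nat_sum)
  then have "((\<Sum>j\<in>J. real (card (?B j))) / real (card J)) ^ card J
      \<le> (real (card A) / real (card J)) ^ card J"
    by (intro power_mono divide_right_mono) (auto intro!: divide_nonneg_nonneg sum_nonneg)
  finally show ?thesis .
qed

text \<open>If \<open>u\<close> plays \<open>i\<close>, every other vertex \<open>w\<close> of the
  copy satisfies \<open>a u w = i\<close> and stands at position \<open>a w u\<close>.\<close>

lemma card_copies_role_le:
  assumes "finite V" "i < k" "k \<ge> 2"
  shows "real (card {f \<in> copies k V a. f i = u})
           \<le> (real (card {w \<in> V. a u w = i}) / real (k - 1)) ^ (k - 1)"
proof -
  have J: "card ({..<k} - {i}) = k - 1" using assms by simp
  then have ne: "{..<k} - {i} \<noteq> {}" using assms by (intro notI) simp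
  have "real (card {f \<in> copies k V a. f i = u})
      \<le> (real (card {w \<in> V. a u w = i}) / real (card ({..<k} - {i}))) ^ card ({..<k} - {i})"
  proof (rule card_le_mean_power[where c = "\<lambda>w. a w u"])
    fix f j assume f: "f \<in> {f \<in> copies k V a. f i = u}" and j: "j \<in> {..<k} - {i}"
    then show "f j \<in> {w \<in> V. a u w = i} \<and> a (f j) u = j"
      using copies_role[of f k V a i j] copies_role[of f k V a j i] copies_mem[of f k V a j] assms(2)
      by auto
  next
    fix f g x assume "f \<in> {f \<in> copies k V a. f i = u}" "g \<in> {f \<in> copies k V a. f i = u}"
      "x \<notin> {..<k} - {i}"
    then show "f x = g x" using copies_undefined[of f k V a x] copies_undefined[of g k V a x] by auto
  qed (use assms ne in auto)
  then show ?thesis unfolding J .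
qed

lemma sum_card_copies_role:
  assumes "finite V" "i < k"
  shows "(\<Sum>u\<in>V. card {f \<in> copies k V a. f i = u}) = card (copies k V a)"
proof -
  have "(\<Sum>u\<in>V. card {f \<in> copies k V a. f i = u}) = card (\<Union>u\<in>V. {f \<in> copies k V a. f i = u})"
    using assms finite_copies[of V k a] by (subst card_UN_disjoint) auto
  also have "(\<Union>u\<in>V. {f \<in> copies k V a. f i = u}) = copies k V a"
    using assms copies_mem by fastforce
  finally show ?thesis .
qed

section \<open>Copies through a vertex or a pair, and cloning\<close>

definition copy_degree :: "nat \<Rightarrow> 'a set \<Rightarrow> ('a \<Rightarrow> 'a \<Rightarrow> nat) \<Rightarrow> 'a \<Rightarrow> nat" where
  "copy_degree k V a u = (\<Sum>i<k. card {f \<in> copies k V a. f i = u})"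

lemma copy_degree_eq:
  assumes "finite V"
  shows "copy_degree k V a u = card {f \<in> copies k V a. u \<in> f ` {..<k}}"
proof -
  have "copy_degree k V a u = card (\<Union>i<k. {f \<in> copies k V a. f i = u})"
    unfolding copy_degree_def using assms finite_copies[of V k a]
    by (subst card_UN_disjoint) (auto simp: copies_inj)
  also have "(\<Union>i<k. {f \<in> copies k V a. f i = u}) = {f \<in> copies k V a. u \<in> f ` {..<k}}"
    by auto
  finally show ?thesis .
qed

lemma sum_copy_degree:
  assumes "finite V"
  shows "(\<Sum>u\<in>V. copy_degree k V a u) = k * card (copies k V a)"
  unfolding copy_degree_def by (subst sum.swap) (simp add: sum_card_copies_role[OF assms])

text \<open>In a copy through \<open>u\<close> and \<open>v\<close> these can only stand at the
  positions \<open>a u v\<close> and \<open>a v u\<close>, which leaves \<open>k - 2\<close> free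
  positions.\<close>

lemma card_copies_through_pair_le:
  assumes "finite V" "u \<noteq> v" "k \<ge> 2"
  shows "card {f \<in> copies k V a. u \<in> f ` {..<k} \<and> v \<in> f ` {..<k}} \<le> card V ^ (k - 2)"
    (is "card ?F \<le> _")
proof (cases "?F = {}")
  case True
  show ?thesis unfolding True by simp
next
  case False
  have roles: "a u v < k \<and> a v u < k \<and> a u v \<noteq> a v u \<and> f (a u v) = u \<and> f (a v u) = v"
    if "f \<in> ?F" for f
  proof -
    obtain i j where ij: "i < k" "j < k" "f i = u" "f j = v" using \<open>f \<in> ?F\<close> by auto
    then have "i \<noteq> j" using assms(2) by auto
    with ij \<open>f \<in> ?F\<close> have "a u v = i" "a v u = j" using copies_role by fastforce+
    with ij \<open>i \<noteq> j\<close> show ?thesis by auto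
  qed
  let ?J = "{..<k} - {a u v, a v u}"
  have "card ?F \<le> (\<Prod>j\<in>?J. card V)"
  proof (rule card_le_prod_card)
    fix f g x assume "f \<in> ?F" "g \<in> ?F" "x \<notin> ?J"
    moreover from this have "x = a u v \<or> x = a v u \<or> \<not> x < k" by blast
    ultimately show "f x = g x"
      using roles[of f] roles[of g] copies_undefined[of f k V a x] copies_undefined[of g k V a x]
      by (elim disjE) simp_all
  qed (use assms in \<open>auto simp: copies_mem\<close>)
  also have "\<dots> = card V ^ card ?J" by simp
  also have "card ?J = k - 2"
  proof -
    obtain f where "f \<in> ?F" using False by blast
    then show ?thesis using roles[of f] by (simp add: card_Diff_subset)
  qed
  finally show ?thesis .
qed

text \<open>Compare \<^term>\<open>a\<close> with the structure in which \<^term>\<open>u\<close> is replaced by a clone of \<^term>\<open>v\<close>.\<close>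

lemma copy_degree_le_of_maximal:
  assumes "finite V" "u \<in> V" "v \<in> V" "k \<ge> 2"
    and max: "\<And>a'. card (copies k V a') \<le> card (copies k V a)"
  shows "copy_degree k V a v \<le> copy_degree k V a u + card V ^ (k - 2)"
proof (cases "u = v")
  case False
  define h where "h = (\<lambda>x. if x = u then v else x)"
  define a' where "a' = (\<lambda>x y. a (h x) (h y))"
  let ?Cu = "{f \<in> copies k V a. u \<in> f ` {..<k}}" and ?Cv = "{f \<in> copies k V a. v \<in> f ` {..<k}}"
  let ?W = "{f \<in> copies k V a. u \<in> f ` {..<k} \<and> v \<in> f ` {..<k}}"
  let ?t = "\<lambda>f. \<lambda>i\<in>{..<k}. if f i = v then u else f i"
  have fin: "finite (copies k V b)" for b using assms(1) finite_copies by blast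
  \<comment> \<open>Copies avoiding \<open>u\<close> survive in \<open>a'\<close>, and each copy
    through \<open>v\<close> but not \<open>u\<close> gives a new one through the clone
    \<open>u\<close>. By maximality the gain \<open>?Cv - ?W\<close> is at most the loss
    \<open>?Cu\<close>.\<close>
  have X1: "copies k V a - ?Cu \<subseteq> copies k V a'"
    by (auto simp: copies_def a'_def h_def)
  have ht: "h (?t f i) = f i" if "f \<in> ?Cv - ?W" "i < k" for f i
    using that by (auto simp: h_def)
  have X2: "?t ` (?Cv - ?W) \<subseteq> copies k V a'"
  proof
    fix g assume "g \<in> ?t ` (?Cv - ?W)"
    then obtain f where f: "f \<in> ?Cv - ?W" "g = ?t f" by blast
    have "g \<in> {..<k} \<rightarrow>\<^sub>E V" using f assms by (auto simp: copies_mem)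
    moreover have "a' (g i) (g j) = i" if "i < k" "j < k" "i \<noteq> j" for i j
      using ht[OF f(1), of i] ht[OF f(1), of j] f(1) that copies_role[of f k V a i j]
      unfolding a'_def f(2) by simp
    ultimately show "g \<in> copies k V a'" by (auto simp: copies_def)
  qed
  have disj: "(copies k V a - ?Cu) \<inter> ?t ` (?Cv - ?W) = {}"
  proof -
    have "u \<in> ?t f ` {..<k}" if "f \<in> ?Cv - ?W" for f using that by (auto simp: image_iff)
    then show ?thesis by fastforce
  qed
  have inj: "inj_on ?t (?Cv - ?W)"
  proof (intro inj_onI ext)
    fix f g i assume fg: "f \<in> ?Cv - ?W" "g \<in> ?Cv - ?W" "?t f = ?t g"
    show "f i = g i"
    proof (cases "i < k")
      case True
      then show ?thesis using ht[OF fg(1)] ht[OF fg(2)] fg(3) by metis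
    next
      case False
      then show ?thesis using copies_undefined[of f k V a i] copies_undefined[of g k V a i] fg(1,2) by simp
    qed
  qed
  have "card (copies k V a - ?Cu) + card (?Cv - ?W) = card ((copies k V a - ?Cu) \<union> ?t ` (?Cv - ?W))"
    using disj fin by (subst card_Un_disjoint) (auto simp: card_image[OF inj])
  also have "\<dots> \<le> card (copies k V a')" using X1 X2 fin by (intro card_mono) auto
  also have "\<dots> \<le> card (copies k V a)" by (rule max)
  finally have "card (?Cv - ?W) \<le> card ?Cu"
    using fin card_mono[OF fin, of ?Cu a] by (subst (asm) card_Diff_subset) auto
  moreover have "card (?Cv - ?W) = card ?Cv - card ?W"
    using fin by (intro card_Diff_subset) auto
  moreover have "card ?W \<le> card V ^ (k - 2)"
    by (rule card_copies_through_pair_le[OF assms(1) False assms(4)])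
  ultimately show ?thesis by (simp add: copy_degree_eq[OF assms(1)])
qed simp

section \<open>Dominant roles\<close>

text \<open>Let \<open>S\<close> be the fibre of \<open>\<rho>\<close> through \<open>i\<close>,
  \<open>S'\<close> the fibre without its possible fixed point \<open>\<rho> i\<close>, and
  \<open>T\<close> its complement. Every pair between \<open>S'\<close> and \<open>T\<close> counts,
  in both orders. Both sets are nonempty with at least \<open>k - 1\<close> elements in total, so
  their product has at least \<open>k - 2\<close>.\<close>

lemma card_nonconstant_pairs_ge:
  fixes \<rho> :: "nat \<Rightarrow> nat"
  assumes "i < k" "j < k" "\<rho> i \<noteq> i" "\<rho> i \<noteq> \<rho> j"
  shows "2 * (k - 2) \<le> card {(i, j). i < k \<and> j < k \<and> \<rho> i \<noteq> \<rho> j \<and> (\<rho> i \<noteq> i \<or> \<rho> j \<noteq> j)}"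
    (is "_ \<le> card ?B")
proof -
  define S where "S = {l. l < k \<and> \<rho> l = \<rho> i}"
  define S' where "S' = S - {\<rho> i}"
  define T where "T = {..<k} - S"
  have fin: "finite S" "finite S'" "finite T" by (auto simp: S_def S'_def T_def)
  have "S \<subseteq> {..<k}" by (auto simp: S_def)
  then have cT: "card T = k - card S" "card S \<le> k"
    using fin card_mono[of "{..<k}" S] by (auto simp: T_def card_Diff_subset)
  have "j \<in> T" using assms by (auto simp: T_def S_def)
  then have t1: "card T \<ge> 1" using fin by (simp add: Suc_le_eq card_gt_0_iff) auto
  have "i \<in> S'" using assms by (auto simp: S'_def S_def)
  then have s1: "card S' \<ge> 1" using fin by (simp add: Suc_le_eq card_gt_0_iff) auto
  have s2: "card S \<le> card S' + 1" unfolding S'_def using fin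
    by (simp add: card_Diff_singleton_if) arith
  have "k - 2 \<le> card S' * card T"
  proof -
    obtain p where p: "card S' = Suc p" using s1 by (cases "card S'") auto
    obtain q where q: "card T = Suc q" using t1 by (cases "card T") auto
    have "k - 2 \<le> p + q + 1" using p q cT s2 by linarith
    also have "\<dots> \<le> Suc p * Suc q" by simp
    finally show ?thesis using p q by simp
  qed
  then have "2 * (k - 2) \<le> card (S' \<times> T) + card (T \<times> S')"
    by (simp add: card_cartesian_product mult.commute)
  also have "\<dots> = card (S' \<times> T \<union> T \<times> S')"
    using fin by (subst card_Un_disjoint) (auto simp: S'_def T_def)
  also have "\<dots> \<le> card ?B"
  proof (rule card_mono)
    show "finite ?B" by (rule finite_subset[of _ "{..<k} \<times> {..<k}"]) auto
  qed (auto simp: S'_def S_def T_def)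
  finally show ?thesis .
qed

text \<open>\<open>r u\<close> is the dominant role of \<open>u\<close>, and \<open>\<zeta>\<close>
  bounds the total size of its other classes. The upper bound takes
  \<open>\<zeta> = 26/(25*k) * s\<close>.\<close>

locale dominated_roles =
  fixes k :: nat and V :: "'a set" and a :: "'a \<Rightarrow> 'a \<Rightarrow> nat" and r :: "'a \<Rightarrow> nat" and \<zeta> :: real
  assumes k4: "k \<ge> 4" and finV: "finite V"
    and r_less: "\<And>u. u \<in> V \<Longrightarrow> r u < k"
    and dom: "\<And>u. u \<in> V \<Longrightarrow> (\<Sum>p\<in>{..<k} - {r u}. real (card {w \<in> V. a u w = p})) \<le> \<zeta>"
begin

definition part :: "nat \<Rightarrow> 'a set" where "part j = {v \<in> V. r v = j}"

text \<open>The relation is symmetric, so \<open>bad_positions\<close> and \<open>bad_pairs\<close>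
  contain each unordered pair in both orders.\<close>

definition bad :: "'a \<Rightarrow> 'a \<Rightarrow> bool" where
  "bad u v \<longleftrightarrow> r u \<noteq> r v \<and> (a u v \<noteq> r u \<or> a v u \<noteq> r v)"

definition bad_positions :: "(nat \<Rightarrow> 'a) \<Rightarrow> (nat \<times> nat) set" where
  "bad_positions f = {(i, j). i < k \<and> j < k \<and> bad (f i) (f j)}"

definition bad_pairs :: "('a \<times> 'a) set" where
  "bad_pairs = {(u, v). u \<in> V \<and> v \<in> V \<and> bad u v}"

text \<open>A transversal is a copy exactly when it has no bad pair. The other transversals are what
  the copies with bad pairs are charged to.\<close>

definition transversals :: "(nat \<Rightarrow> 'a) set" where
  "transversals = (\<Pi>\<^sub>E j\<in>{..<k}. part j)"

lemma finite_part: "finite (part j)" using finV by (simp add: part_def)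

lemma finite_bad_positions: "finite (bad_positions f)"
  by (rule finite_subset[of _ "{..<k} \<times> {..<k}"]) (auto simp: bad_positions_def)

lemma finite_bad_pairs: "finite bad_pairs"
  by (rule finite_subset[of _ "V \<times> V"]) (use finV in \<open>auto simp: bad_pairs_def\<close>)

lemma finite_transversals: "finite transversals"
  unfolding transversals_def by (intro finite_PiE) (auto simp: finite_part)

lemma nondominant_class_le:
  assumes "u \<in> V" "p < k" "p \<noteq> r u"
  shows "real (card {w \<in> V. a u w = p}) \<le> \<zeta>"
proof -
  have "real (card {w \<in> V. a u w = p}) \<le> (\<Sum>p\<in>{..<k} - {r u}. real (card {w \<in> V. a u w = p}))"
    using assms by (intro member_le_sum) auto
  then show ?thesis using dom[OF assms(1)] by linarith
qed

text \<open>The nondominant classes have total size at most \<open>\<zeta>\<close>, and a sum of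
  powers is at most the power of the sum.\<close>

lemma nondominant_degree_le:
  assumes "u \<in> V"
  shows "(\<Sum>p\<in>{..<k} - {r u}. real (card {f \<in> copies k V a. f p = u})) \<le> (\<zeta> / real (k - 1)) ^ (k - 1)"
proof -
  let ?c = "\<lambda>p. real (card {w \<in> V. a u w = p})"
  have "(\<Sum>p\<in>{..<k} - {r u}. real (card {f \<in> copies k V a. f p = u}))
      \<le> (\<Sum>p\<in>{..<k} - {r u}. (?c p / real (k - 1)) ^ (k - 1))"
    using k4 finV by (intro sum_mono card_copies_role_le) auto
  also have "\<dots> \<le> (\<Sum>p\<in>{..<k} - {r u}. ?c p / real (k - 1)) ^ (k - 1)"
    using k4 by (intro sum_power_le_power_sum) auto
  also have "\<dots> \<le> (\<zeta> / real (k - 1)) ^ (k - 1)"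
    unfolding sum_divide_distrib[symmetric]
    by (intro power_mono divide_right_mono dom[OF assms] divide_nonneg_nonneg sum_nonneg) auto
  finally show ?thesis .
qed

text \<open>Each \<open>u\<close> in \<open>part j\<close> plays \<open>j\<close> in all but its few
  nondominant copies, and every copy has exactly one vertex at position \<open>j\<close>. A lower
  bound on degrees thus bounds the part sizes from above.\<close>

lemma card_part_le:
  assumes "j < k" and deg: "\<And>u. u \<in> V \<Longrightarrow> D \<le> real (copy_degree k V a u)"
  shows "real (card (part j)) * (D - (\<zeta> / real (k - 1)) ^ (k - 1)) \<le> real (card (copies k V a))"
proof -
  have "D - (\<zeta> / real (k - 1)) ^ (k - 1) \<le> real (card {f \<in> copies k V a. f j = u})"
    if "u \<in> part j" for u
  proof -
    have u: "u \<in> V" "r u = j" using that by (auto simp: part_def)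
    have "real (copy_degree k V a u) = real (card {f \<in> copies k V a. f j = u})
        + (\<Sum>p\<in>{..<k} - {r u}. real (card {f \<in> copies k V a. f p = u}))"
      unfolding copy_degree_def of_nat_sum using assms(1) u by (subst sum.remove[of _ j]) auto
    then show ?thesis using deg[OF u(1)] nondominant_degree_le[OF u(1)] by linarith
  qed
  then have "(\<Sum>u\<in>part j. D - (\<zeta> / real (k - 1)) ^ (k - 1))
      \<le> (\<Sum>u\<in>part j. real (card {f \<in> copies k V a. f j = u}))" by (intro sum_mono) auto
  also have "\<dots> \<le> (\<Sum>u\<in>V. real (card {f \<in> copies k V a. f j = u}))"
    using finV by (intro sum_mono2) (auto simp: part_def)
  also have "\<dots> = real (card (copies k V a))"
    by (simp flip: of_nat_sum add: sum_card_copies_role[OF finV assms(1)])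
  finally show ?thesis by simp
qed

section \<open>Double counting of bad pairs\<close>

definition copies_at :: "'a \<times> 'a \<Rightarrow> (nat \<Rightarrow> 'a) set" where
  "copies_at = (\<lambda>(u, v). {f \<in> copies k V a.
     a u v < k \<and> a v u < k \<and> a u v \<noteq> a v u \<and> f (a u v) = u \<and> f (a v u) = v})"

text \<open>At one end of a bad pair, say \<open>u\<close>, the role \<open>a u v\<close> is not
  dominant. The other \<open>k - 2\<close> vertices of a copy through the pair then lie in the class
  \<open>{w \<in> V. a u w = a u v}\<close>, of size at most \<open>\<zeta>\<close>. The other case
  is the same with \<open>u\<close> and \<open>v\<close> exchanged.\<close>

lemma card_copies_at_le:
  assumes "e \<in> bad_pairs"
  shows "real (card (copies_at e)) \<le> (\<zeta> / real (k - 2)) ^ (k - 2)"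
proof -
  have *: "real (card (copies_at (u, v))) \<le> (\<zeta> / real (k - 2)) ^ (k - 2)"
    if uv: "u \<in> V" "v \<in> V" "a u v \<noteq> r u" for u v
  proof (cases "copies_at (u, v) = {}")
    case True
    have "0 \<le> \<zeta>" using dom[OF uv(1)] by (rule order_trans[rotated]) (simp add: sum_nonneg)
    then show ?thesis using True by simp
  next
    case False
    then have p: "a u v < k" "a v u < k" "a u v \<noteq> a v u" by (auto simp: copies_at_def)
    let ?J = "{..<k} - {a u v, a v u}"
    have J: "card ?J = k - 2" using p by (subst card_Diff_subset) auto
    then have ne: "?J \<noteq> {}" using k4 by (intro notI) simp
    have "real (card (copies_at (u, v))) \<le> (real (card {w \<in> V. a u w = a u v}) / real (card ?J)) ^ card ?J"
    proof (rule card_le_mean_power[where c = "\<lambda>w. a w u"])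
      fix f j assume f: "f \<in> copies_at (u, v)" and j: "j \<in> ?J"
      then have c: "f \<in> copies k V a" "f (a u v) = u" "j < k" "j \<noteq> a u v" by (auto simp: copies_at_def)
      then show "f j \<in> {w \<in> V. a u w = a u v} \<and> a (f j) u = j"
        using copies_role[OF c(1) p(1) c(3)] copies_role[OF c(1) c(3) p(1)] copies_mem[OF c(1) c(3)]
        by auto
    next
      fix f g x assume "f \<in> copies_at (u, v)" "g \<in> copies_at (u, v)" "x \<notin> ?J"
      moreover from this have "x = a u v \<or> x = a v u \<or> \<not> x < k" by blast
      ultimately show "f x = g x"
        using copies_undefined[of f k V a x] copies_undefined[of g k V a x]
        by (elim disjE) (simp_all add: copies_at_def)
    qed (use finV ne in auto)
    also have "\<dots> \<le> (\<zeta> / real (k - 2)) ^ (k - 2)"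
      unfolding J using nondominant_class_le[OF uv(1) p(1) uv(3)]
      by (intro power_mono divide_right_mono) auto
    finally show ?thesis .
  qed
  obtain u v where e: "e = (u, v)" "u \<in> V" "v \<in> V" "a u v \<noteq> r u \<or> a v u \<noteq> r v"
    using assms by (auto simp: bad_pairs_def bad_def)
  have "copies_at (u, v) = copies_at (v, u)" by (auto simp: copies_at_def)
  then show ?thesis using *[of u v] *[of v u] e by auto
qed

text \<open>Send a copy with a bad position \<open>(i, j)\<close> to the bad pair
  \<open>(f i, f j)\<close> and \<open>f\<close>. The position is recovered from the roles on that
  pair.\<close>

lemma sum_bad_positions_copies_le:
  "(\<Sum>f\<in>copies k V a. card (bad_positions f)) \<le> (\<Sum>e\<in>bad_pairs. card (copies_at e))"
proof -
  let ?X = "SIGMA f:copies k V a. bad_positions f" and ?Y = "SIGMA e:bad_pairs. copies_at e"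
  let ?t = "\<lambda>(f, (i, j)). ((f i, f j), f)"
  have finc: "finite (copies k V a)" by (rule finite_copies[OF finV])
  have ne: "i \<noteq> j" if "(i, j) \<in> bad_positions f" for i j f
    using that by (auto simp: bad_positions_def bad_def)
  have rl: "a (f i) (f j) = i \<and> a (f j) (f i) = j \<and> i < k \<and> j < k"
    if "f \<in> copies k V a" "(i, j) \<in> bad_positions f" for f i j
    using that ne[OF that(2)] copies_role[OF that(1)] by (auto simp: bad_positions_def)
  have "card ?X \<le> card ?Y"
  proof (rule card_inj_on_le[of ?t])
    show "inj_on ?t ?X"
      using rl by (intro inj_onI) (auto, metis+)
    show "?t ` ?X \<subseteq> ?Y"
    proof clarify
      fix f i j assume fij: "f \<in> copies k V a" "(i, j) \<in> bad_positions f"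
      then show "(f i, f j) \<in> bad_pairs \<and> f \<in> copies_at (f i, f j)"
        using rl[OF fij] ne[OF fij(2)]
        by (auto simp: bad_pairs_def bad_positions_def copies_at_def copies_mem)
    qed
    show "finite ?Y" using finc finite_bad_pairs by (intro finite_SigmaI) (auto simp: copies_at_def)
  qed
  then show ?thesis using finc finite_bad_pairs finite_bad_positions
    by (subst (asm) (1 2) card_SigmaI) (auto simp: copies_at_def)
qed

definition transversals_at :: "'a \<times> 'a \<Rightarrow> (nat \<Rightarrow> 'a) set" where
  "transversals_at = (\<lambda>(u, v). {f \<in> transversals. f (r u) = u \<and> f (r v) = v})"

lemma card_transversals_at:
  assumes "e \<in> bad_pairs"
  shows "card (transversals_at e) = (\<Prod>j\<in>{..<k} - {r (fst e), r (snd e)}. card (part j))"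
proof -
  obtain u v where e: "e = (u, v)" "u \<in> V" "v \<in> V" "r u \<noteq> r v"
    using assms by (auto simp: bad_pairs_def bad_def)
  let ?B = "\<lambda>j. if j = r u then {u} else if j = r v then {v} else part j"
  have "transversals_at e = (\<Pi>\<^sub>E j\<in>{..<k}. ?B j)"
  proof (intro set_eqI iffI)
    fix f assume f: "f \<in> transversals_at e"
    then have "f \<in> (\<Pi>\<^sub>E j\<in>{..<k}. part j)" "f (r u) = u" "f (r v) = v"
      by (simp_all add: transversals_at_def transversals_def e)
    then show "f \<in> (\<Pi>\<^sub>E j\<in>{..<k}. ?B j)" by (simp add: PiE_iff)
  next
    fix f assume f: "f \<in> (\<Pi>\<^sub>E j\<in>{..<k}. ?B j)"
    have "f (r u) \<in> ?B (r u)" "f (r v) \<in> ?B (r v)"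
      using PiE_mem[OF f] r_less e by blast+
    then have fu: "f (r u) = u" "f (r v) = v" using e by simp_all
    have "f j \<in> part j" if "j < k" for j
      using PiE_mem[OF f, of j] that e by (auto simp: part_def split: if_splits)
    then have "f \<in> transversals" using f by (simp add: transversals_def PiE_iff)
    then show "f \<in> transversals_at e" using fu by (simp add: transversals_at_def e)
  qed
  then have "card (transversals_at e) = (\<Prod>j<k. card (?B j))" by (simp add: card_PiE)
  also have "\<dots> = (\<Prod>j\<in>{..<k} - {r u, r v}. card (?B j))"
    by (rule prod.mono_neutral_right) auto
  also have "\<dots> = (\<Prod>j\<in>{..<k} - {r u, r v}. card (part j))"
    by (rule prod.cong) auto
  finally show ?thesis using e by simp
qed

text \<open>A transversal through a bad pair has its ends at the positions \<open>r u\<close> and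
  \<open>r v\<close>, and the pair is recovered from these positions.\<close>

lemma sum_bad_positions_transversals_ge:
  "(\<Sum>e\<in>bad_pairs. card (transversals_at e)) \<le> (\<Sum>f\<in>transversals. card (bad_positions f))"
proof -
  let ?X = "SIGMA f:transversals. bad_positions f" and ?Y = "SIGMA e:bad_pairs. transversals_at e"
  let ?t = "\<lambda>((u, v), f). (f, (r u, r v))"
  have "card ?Y \<le> card ?X"
  proof (rule card_inj_on_le[of ?t])
    show "inj_on ?t ?Y"
    proof (rule inj_onI)
      fix x y assume xy: "x \<in> ?Y" "y \<in> ?Y" "?t x = ?t y"
      obtain u v f where x: "x = ((u, v), f)" by (metis prod.exhaust)
      obtain u' v' g where y: "y = ((u', v'), g)" by (metis prod.exhaust)
      have eq: "g = f" "r u' = r u" "r v' = r v" using xy(3) by (simp_all add: x y)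
      have "f (r u) = u" "f (r v) = v" "g (r u') = u'" "g (r v') = v'"
        using xy(1,2) by (simp_all add: x y transversals_at_def)
      then show "x = y" unfolding eq x y by simp
    qed
    show "?t ` ?Y \<subseteq> ?X"
      by (auto simp: transversals_at_def bad_positions_def bad_pairs_def r_less)
    show "finite ?X" using finite_transversals finite_bad_positions by (intro finite_SigmaI) auto
  qed
  then show ?thesis using finite_transversals finite_bad_pairs finite_bad_positions
    by (subst (asm) (1 2) card_SigmaI) (auto simp: transversals_at_def)
qed

text \<open>Within a copy, \<open>f i\<close> has role \<open>i\<close> on its edges, so badness
  depends only on the map sending \<open>i\<close> to \<open>r (f i)\<close>, and
  \<open>card_nonconstant_pairs_ge\<close> applies.\<close>

lemma card_bad_positions_copy_ge:
  assumes "f \<in> copies k V a" "bad_positions f \<noteq> {}"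
  shows "2 * (k - 2) \<le> card (bad_positions f)"
proof -
  have eq: "bad_positions f = {(i, j). i < k \<and> j < k \<and> r (f i) \<noteq> r (f j) \<and> (r (f i) \<noteq> i \<or> r (f j) \<noteq> j)}"
  proof -
    have "bad (f i) (f j) \<longleftrightarrow> r (f i) \<noteq> r (f j) \<and> (r (f i) \<noteq> i \<or> r (f j) \<noteq> j)" if "i < k" "j < k" for i j
      using that copies_role[OF assms(1), of i j] copies_role[OF assms(1), of j i]
      by (cases "i = j") (auto simp: bad_def)
    then show ?thesis by (auto simp: bad_positions_def)
  qed
  obtain i j where "i < k" "j < k" "r (f i) \<noteq> i" "r (f i) \<noteq> r (f j)"
  proof -
    obtain i j where ij: "i < k" "j < k" "r (f i) \<noteq> r (f j)" "r (f i) \<noteq> i \<or> r (f j) \<noteq> j"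
      using assms(2) unfolding eq by blast
    then show ?thesis using that[of i j] that[of j i] by metis
  qed
  then show ?thesis unfolding eq by (rule card_nonconstant_pairs_ge[where \<rho> = "\<lambda>i. r (f i)"])
qed

text \<open>If \<open>f i\<close> lies outside \<open>part i\<close>, any vertex of the copy in
  another part than \<open>f i\<close> would form a bad pair with it; so all lie in the part of
  \<open>f i\<close>.\<close>

lemma copy_cases:
  assumes "f \<in> copies k V a" "bad_positions f = {}"
  shows "f \<in> transversals \<or> (\<exists>j<k. f \<in> copies k (part j) a)"
proof (cases "\<forall>i<k. r (f i) = i")
  case True
  then show ?thesis using assms(1) by (auto simp: transversals_def part_def copies_def PiE_iff)
next
  case False
  then obtain i where i: "i < k" "r (f i) \<noteq> i" by blast
  have "r (f j) = r (f i)" if j: "j < k" for j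
  proof (rule ccontr)
    assume ne: "r (f j) \<noteq> r (f i)"
    then have "i \<noteq> j" by auto
    then have "bad (f i) (f j)" using ne i j copies_role[OF assms(1) i(1) j] by (auto simp: bad_def)
    then show False using assms(2) i j by (auto simp: bad_positions_def)
  qed
  then have "f \<in> copies k (part (r (f i))) a"
    using assms(1) by (auto simp: copies_def part_def PiE_iff)
  then show ?thesis using r_less[OF copies_mem[OF assms(1) i(1)]] by blast
qed

text \<open>With \<open>E\<close> bad pairs and \<open>\<kappa> = (\<zeta>/(k - 2))^(k - 2)\<close>,
  counting incidences gives \<open>2*(k - 2) * card B \<le> E * \<kappa>\<close> for the copies and
  \<open>E * \<tau> \<le> k*(k - 1) * card G\<close> for the transversals. Eliminating
  \<open>E\<close> by \<open>ineq\<close> yields the claim.\<close>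

lemma card_bad_copies_le:
  assumes "\<tau> > 0"
    and tau: "\<And>i j. i < k \<Longrightarrow> j < k \<Longrightarrow> i \<noteq> j \<Longrightarrow> \<tau> \<le> (\<Prod>l\<in>{..<k} - {i, j}. real (card (part l)))"
    and ineq: "(\<zeta> / real (k - 2)) ^ (k - 2) * (real k * real (k - 1)) \<le> 2 * real (k - 2) * \<tau>"
  shows "card {f \<in> copies k V a. bad_positions f \<noteq> {}} \<le> card {f \<in> transversals. bad_positions f \<noteq> {}}"
    (is "card ?B \<le> card ?G")
proof -
  have finc: "finite (copies k V a)" by (rule finite_copies[OF finV])
  let ?E = "real (card bad_pairs)" and ?\<kappa> = "(\<zeta> / real (k - 2)) ^ (k - 2)"
  have "2 * (k - 2) * card ?B = (\<Sum>f\<in>?B. 2 * (k - 2))" by simp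
  also have "\<dots> \<le> (\<Sum>f\<in>?B. card (bad_positions f))"
    by (intro sum_mono card_bad_positions_copy_ge) auto
  also have "\<dots> \<le> (\<Sum>f\<in>copies k V a. card (bad_positions f))"
    using finc by (intro sum_mono2) auto
  also have "\<dots> \<le> (\<Sum>e\<in>bad_pairs. card (copies_at e))" by (rule sum_bad_positions_copies_le)
  finally have "real (2 * (k - 2) * card ?B) \<le> (\<Sum>e\<in>bad_pairs. real (card (copies_at e)))"
    by (simp only: of_nat_le_iff flip: of_nat_sum)
  also have "\<dots> \<le> (\<Sum>e\<in>bad_pairs. ?\<kappa>)" by (intro sum_mono card_copies_at_le)
  finally have 1: "2 * real (k - 2) * real (card ?B) \<le> ?E * ?\<kappa>" by simp
  have "?E * \<tau> = (\<Sum>e\<in>bad_pairs. \<tau>)" by simp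
  also have "\<dots> \<le> (\<Sum>e\<in>bad_pairs. real (card (transversals_at e)))"
  proof (intro sum_mono)
    fix e assume e: "e \<in> bad_pairs"
    then show "\<tau> \<le> real (card (transversals_at e))"
      unfolding card_transversals_at[OF e] of_nat_prod
      by (intro tau) (auto simp: bad_pairs_def bad_def r_less)
  qed
  also have "\<dots> \<le> real (\<Sum>f\<in>transversals. card (bad_positions f))"
    using sum_bad_positions_transversals_ge by (simp only: of_nat_le_iff flip: of_nat_sum)
  also have "(\<Sum>f\<in>transversals. card (bad_positions f)) = (\<Sum>f\<in>?G. card (bad_positions f))"
    using finite_transversals by (intro sum.mono_neutral_right) auto
  also have "real \<dots> \<le> real (\<Sum>f\<in>?G. k * (k - 1))"
  proof (intro of_nat_mono sum_mono)
    fix f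
    have "bad_positions f \<subseteq> (SIGMA i:{..<k}. {..<k} - {i})"
      by (auto simp: bad_positions_def bad_def)
    then have "card (bad_positions f) \<le> card (SIGMA i:{..<k}. {..<k} - {i})"
      by (intro card_mono) auto
    also have "\<dots> = k * (k - 1)" by simp
    finally show "card (bad_positions f) \<le> k * (k - 1)" .
  qed
  finally have 2: "?E * \<tau> \<le> real k * real (k - 1) * real (card ?G)" by (simp add: mult_ac)
  show ?thesis
  proof (cases "bad_pairs = {}")
    case True
    then show ?thesis using 1 k4 by (simp add: mult_le_0_iff)
  next
    case False
    then obtain u where "u \<in> V" by (auto simp: bad_pairs_def)
    then have "0 \<le> \<zeta>" by (intro order_trans[OF _ dom]) (simp_all add: sum_nonneg)
    then have \<kappa>: "?\<kappa> \<ge> 0" by simp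
    have "(2 * real (k - 2) * \<tau>) * real (card ?B) \<le> (?E * \<tau>) * ?\<kappa>"
      using mult_right_mono[OF 1, of \<tau>] \<open>\<tau> > 0\<close> by (simp add: mult_ac)
    also have "\<dots> \<le> (real k * real (k - 1) * real (card ?G)) * ?\<kappa>"
      by (rule mult_right_mono[OF 2 \<kappa>])
    also have "\<dots> \<le> (2 * real (k - 2) * \<tau>) * real (card ?G)"
      using mult_right_mono[OF ineq, of "real (card ?G)"] by (simp add: mult_ac)
    finally have "real (card ?B) \<le> real (card ?G)"
      using \<open>\<tau> > 0\<close> k4 by (subst (asm) mult_le_cancel_left_pos) auto
    then show ?thesis by simp
  qed
qed

text \<open>Trading the copies with bad pairs for transversals with bad pairs leaves at most all
  transversals, plus the copies inside the parts.\<close>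

lemma card_copies_le_parts:
  assumes "\<tau> > 0"
    and tau: "\<And>i j. i < k \<Longrightarrow> j < k \<Longrightarrow> i \<noteq> j \<Longrightarrow> \<tau> \<le> (\<Prod>l\<in>{..<k} - {i, j}. real (card (part l)))"
    and ineq: "(\<zeta> / real (k - 2)) ^ (k - 2) * (real k * real (k - 1)) \<le> 2 * real (k - 2) * \<tau>"
  shows "card (copies k V a) \<le> (\<Prod>j<k. card (part j)) + (\<Sum>j<k. card (copies k (part j) a))"
proof -
  let ?B = "{f \<in> copies k V a. bad_positions f \<noteq> {}}" and ?G = "{f \<in> transversals. bad_positions f \<noteq> {}}"
  let ?Good = "{f \<in> transversals. bad_positions f = {}}" and ?I = "\<Union>j<k. copies k (part j) a"
  have finc: "finite (copies k W a)" if "finite W" for W by (rule finite_copies[OF that])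
  have "copies k V a \<subseteq> (?B \<union> ?Good) \<union> ?I"
  proof
    fix f assume "f \<in> copies k V a"
    then show "f \<in> (?B \<union> ?Good) \<union> ?I" using copy_cases[of f] by blast
  qed
  then have "card (copies k V a) \<le> card ((?B \<union> ?Good) \<union> ?I)"
    using finV finite_part finite_transversals finc by (intro card_mono) auto
  also have "\<dots> \<le> card ?B + card ?Good + card ?I"
    by (rule order_trans[OF card_Un_le add_right_mono[OF card_Un_le]])
  also have "card ?I \<le> (\<Sum>j<k. card (copies k (part j) a))" by (rule card_UN_le) simp
  also have "card ?B \<le> card ?G" by (rule card_bad_copies_le[OF assms])
  also have "card ?G + card ?Good = card (?G \<union> ?Good)"
    using finite_transversals by (subst card_Un_disjoint) auto
  also have "?G \<union> ?Good = transversals" by auto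
  also have "card transversals = (\<Prod>j<k. card (part j))"
    by (simp add: transversals_def card_PiE)
  finally show ?thesis by simp
qed

end

section \<open>The upper bound\<close>

text \<open>Apply the Weierstrass product inequality to the deficits \<open>1 - x i / M\<close>;
  these are nonnegative, so their sum over \<open>J\<close> is at most that over
  \<open>A\<close>.\<close>

lemma prod_ge_of_nearly_balanced:
  fixes x :: "'a \<Rightarrow> real"
  assumes "finite A" "J \<subseteq> A" "M > 0" "\<And>i. i \<in> A \<Longrightarrow> 0 \<le> x i \<and> x i \<le> M"
  shows "M ^ card J * (1 - (card A - (\<Sum>i\<in>A. x i) / M)) \<le> (\<Prod>i\<in>J. x i)"
proof -
  have "1 - (\<Sum>i\<in>A. 1 - x i / M) \<le> 1 - (\<Sum>i\<in>J. 1 - x i / M)"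
    using assms by (intro diff_left_mono sum_mono2) auto
  also have "\<dots> \<le> (\<Prod>i\<in>J. 1 - (1 - x i / M))"
    using assms by (intro Weierstrass_prod_ineq) auto
  also have "\<dots> = (\<Prod>i\<in>J. x i) / M ^ card J" by (simp add: prod_dividef)
  finally have "M ^ card J * (1 - (\<Sum>i\<in>A. 1 - x i / M)) \<le> (\<Prod>i\<in>J. x i)"
    using assms(3) by (simp add: field_simps)
  then show ?thesis by (simp add: sum_subtractf sum_divide_distrib)
qed

text \<open>Summing the cloning inequality over all \<open>v\<close> compares the degree of
  \<open>u\<close> with the average degree.\<close>

lemma copy_degree_ge_of_maximal:
  assumes "finite V" "u \<in> V" "k \<ge> 2"
    and max: "\<And>a'. card (copies k V a') \<le> card (copies k V a)"
  shows "k * card (copies k V a) \<le> card V * copy_degree k V a u + card V ^ (k - 1)"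
proof -
  have "k * card (copies k V a) = (\<Sum>v\<in>V. copy_degree k V a v)"
    using sum_copy_degree[OF assms(1), where k = k and a = a] by simp
  also have "\<dots> \<le> (\<Sum>v\<in>V. copy_degree k V a u + card V ^ (k - 2))"
    by (intro sum_mono copy_degree_le_of_maximal[OF assms(1,2) _ assms(3) max])
  also have "\<dots> = card V * copy_degree k V a u + card V * card V ^ (k - 2)"
    by (simp add: algebra_simps)
  also have "card V * card V ^ (k - 2) = card V ^ (k - 1)"
    using power_minus_mult[of "k - 1" "card V"] assms(3) by (simp add: mult.commute numeral_2_eq_2)
  finally show ?thesis .
qed

text \<open>The threshold in \<open>deg\<close> is the average degree when there are
  \<open>s^k / (k^k - k)\<close> copies. As role \<open>p\<close> contributes at most the
  \<open>(k - 1)\<close>-th power of its class size over \<open>k - 1\<close>, the power sum of the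
  class sizes is large enough for \<open>dominant_index\<close>.\<close>

lemma dominant_role:
  assumes k: "k \<ge> 4" and "finite V" "u \<in> V"
    and deg: "real (card V) ^ (k - 1) / (real k ^ (k - 1) - 1) \<le> real (copy_degree k V a u)"
  shows "\<exists>r<k. (\<Sum>p\<in>{..<k}-{r}. real (card {w \<in> V. a u w = p})) \<le> 26/(25 * real k) * real (card V)"
proof (rule dominant_index)
  let ?m = "k - 1"
  have "(\<Sum>p<k. card {w \<in> V. a u w = p}) = card (\<Union>p<k. {w \<in> V. a u w = p})"
    using assms by (subst card_UN_disjoint) auto
  also have "\<dots> \<le> card V" using assms by (intro card_mono) auto
  finally show "(\<Sum>p<k. real (card {w \<in> V. a u w = p})) \<le> real (card V)"
    by (simp flip: of_nat_sum)
  show "(1/2) ^ (?m - 1) < real ?m ^ ?m / (real k ^ ?m - 1)" by (rule numeric_half[OF k])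
  show "(1 - 26/(25 * real k)) ^ ?m + (26/(25 * real k)) ^ ?m < real ?m ^ ?m / (real k ^ ?m - 1)"
    by (rule numeric_spread[OF k])
  have "real (copy_degree k V a u) \<le> (\<Sum>p<k. (real (card {w \<in> V. a u w = p}) / real ?m) ^ ?m)"
    unfolding copy_degree_def of_nat_sum using assms by (intro sum_mono card_copies_role_le) auto
  also have "\<dots> = (\<Sum>p<k. real (card {w \<in> V. a u w = p}) ^ ?m) / real ?m ^ ?m"
    by (simp add: power_divide sum_divide_distrib)
  finally have "real (card V) ^ ?m / (real k ^ ?m - 1) \<le> (\<Sum>p<k. real (card {w \<in> V. a u w = p}) ^ ?m) / real ?m ^ ?m"
    using deg by linarith
  moreover have "real ?m ^ ?m > 0" using k by simp
  ultimately show "real ?m ^ ?m / (real k ^ ?m - 1) * real (card V) ^ ?m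
      \<le> (\<Sum>p<k. real (card {w \<in> V. a u w = p}) ^ ?m)"
    by (simp add: pos_le_divide_eq mult_ac)
  show "real (card V) > 0" using assms by (auto simp: card_gt_0_iff)
qed (use k in \<open>auto simp: field_simps\<close>)

text \<open>The coefficient \<open>1/(k * \<epsilon>)\<close> makes \<open>k * \<epsilon>\<close>
  times the bound equal to \<open>\<epsilon> * s^k / (k^(k - 1) - 1) + s^(k - 1)\<close>. This pays
  at once for the nondominant copies at a vertex and for the loss from cloning.\<close>

theorem card_copies_upper_bound:
  fixes V :: "'a set"
  assumes k: "k \<ge> 4" and "finite V"
  defines "\<epsilon> \<equiv> (26/(25 * real (k - 1))) ^ (k - 1)"
  shows "real (card (copies k V a))
           \<le> real (card V) ^ k / (real k ^ k - real k) + real (card V) ^ (k - 1) / (real k * \<epsilon>)"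
  using \<open>finite V\<close>
proof (induction "card V" arbitrary: V a rule: less_induct)
  case less
  define s where "s = real (card V)"
  define m where "m = k - 1"
  have m: "k = Suc m" using k by (simp add: m_def)
  have \<epsilon>: "\<epsilon> > 0" "real k * \<epsilon> \<le> 1/5"
    using k numeric_eps(1)[OF k] by (auto simp: \<epsilon>_def)
  have "1 * \<epsilon> \<le> real k * \<epsilon>" using k \<epsilon> by (intro mult_right_mono) auto
  with \<epsilon> have \<epsilon>1: "\<epsilon> < 1" "1 - \<epsilon> > 0" by linarith+
  have km: "real k ^ m > 1" using k by (intro one_less_power) (auto simp: m_def)
  have kk: "real k ^ k - real k = real k * (real k ^ m - 1)" by (simp add: m algebra_simps)
  have kk0: "real k ^ k - real k > 0" unfolding kk using km k by simp
  let ?bound = "s ^ k / (real k ^ k - real k) + s ^ m / (real k * \<epsilon>)"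
  show ?case
  proof (rule ccontr)
    assume "\<not> ?thesis"
    then have viol: "?bound < real (card (copies k V a))" by (simp add: s_def m_def)
    \<comment> \<open>The number of copies is at most \<open>card V ^ k\<close>, so a maximising
      \<open>b\<close> exists; it violates the bound as well.\<close>
    obtain b where max: "card (copies k V a') \<le> card (copies k V b)" for a'
      using ex_has_greatest_nat[of "\<lambda>_. True" a "\<lambda>a'. card (copies k V a')" "Suc (card V ^ k)"]
        card_copies_le[OF less.prems] by (auto simp: less_Suc_eq_le)
    define N where "N = real (card (copies k V b))"
    have N: "?bound < N" using viol max[of a] by (simp add: N_def)
    have "N > 0" using N kk0 \<epsilon> k by (intro le_less_trans[OF _ N]) (simp add: s_def)
    have "V \<noteq> {}"
    proof
      assume "V = {}"
      then have "copies k V b = {}" using copies_mem[of _ k V b 0] k by fastforce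
      then show False using \<open>N > 0\<close> by (simp add: N_def)
    qed
    then have s: "s > 0" using less.prems by (simp add: s_def card_gt_0_iff)
    define D where "D = (real k * N - s ^ m) / s"
    have deg: "D \<le> real (copy_degree k V b u)" if "u \<in> V" for u
    proof -
      have "real (k * card (copies k V b)) \<le> real (card V * copy_degree k V b u + card V ^ (k - 1))"
        using copy_degree_ge_of_maximal[OF less.prems that _ max] k by (simp only: of_nat_le_iff)
      then show ?thesis using s by (simp add: D_def N_def s_def m_def divide_le_eq mult.commute)
    qed
    have D_ge: "s ^ m / (real k ^ m - 1) \<le> D"
    proof -
      have "s ^ m \<le> s ^ m / \<epsilon>" using \<epsilon> \<epsilon>1 s by (simp add: field_simps)
      moreover have "real k * ?bound = s ^ k / (real k ^ m - 1) + s ^ m / \<epsilon>"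
        unfolding kk using k by (simp add: distrib_left)
      moreover have "real k * ?bound \<le> real k * N" using N by (intro mult_left_mono) auto
      ultimately have "s ^ k / (real k ^ m - 1) \<le> real k * N - s ^ m" by linarith
      then show ?thesis using s by (simp add: D_def m pos_le_divide_eq mult_ac)
    qed
    define z where "z = 26/(25 * real k)"
    have "\<exists>r<k. (\<Sum>p\<in>{..<k}-{r}. real (card {w \<in> V. b u w = p})) \<le> z * s" if "u \<in> V" for u
      using dominant_role[OF k less.prems that, of b] D_ge deg[OF that] by (simp add: z_def s_def m_def)
    then obtain r where r: "\<And>u. u \<in> V \<Longrightarrow> r u < k"
      "\<And>u. u \<in> V \<Longrightarrow> (\<Sum>p\<in>{..<k}-{r u}. real (card {w \<in> V. b u w = p})) \<le> z * s"
      by metis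
    interpret dominated_roles k V b r "z * s"
      using k less.prems r by unfold_locales
    define n where "n = (\<lambda>j. real (card (part j)))"
    have n_sum: "(\<Sum>j<k. n j) = s"
    proof -
      have "(\<Sum>j<k. card (part j)) = card (\<Union>j<k. part j)"
        using finite_part by (subst card_UN_disjoint) (auto simp: part_def)
      also have "(\<Union>j<k. part j) = V" using r(1) by (auto simp: part_def)
      finally show ?thesis by (simp add: n_def s_def flip: of_nat_sum)
    qed
    \<comment> \<open>The balanced size is \<open>s / k\<close>; the factor
      \<open>1 - \<epsilon>\<close> is the share of the average degree left after subtracting the
      nondominant copies and the cloning loss.\<close>
    define M where "M = s / (real k * (1 - \<epsilon>))"
    have M: "M > 0" using s \<epsilon>1 k by (simp add: M_def)
    have n_le: "n j \<le> M" if "j < k" for j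
    proof -
      have "n j * (D - (z * s / real m) ^ m) \<le> N"
        using card_part_le[OF that deg] by (simp add: n_def N_def m_def)
      then have "n j * (D - (z * s / real m) ^ m) * s \<le> N * s"
        using s by (intro mult_right_mono) auto
      moreover have "(D - (z * s / real m) ^ m) * s \<ge> real k * (1 - \<epsilon>) * N"
      proof -
        have "z * s / real m = (26/(25 * real m)) * (s / real k)" by (simp add: z_def)
        then have "(z * s / real m) ^ m = \<epsilon> * (s ^ m / real k ^ m)"
          by (simp add: \<epsilon>_def m_def power_mult_distrib power_divide)
        then have zs: "(z * s / real m) ^ m * s = \<epsilon> * (s ^ k / real k ^ m)"
          by (simp add: m)
        have "\<epsilon> * (s ^ k / real k ^ m) \<le> \<epsilon> * (s ^ k / (real k ^ m - 1))"
          using km s \<epsilon> k by (intro mult_left_mono divide_left_mono mult_pos_pos) auto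
        also have "\<dots> + s ^ m = real k * \<epsilon> * ?bound"
          unfolding kk using k \<epsilon> by (simp add: distrib_left)
        also have "\<dots> \<le> real k * \<epsilon> * N" using N \<epsilon> by (intro mult_left_mono) auto
        finally have "\<epsilon> * (s ^ k / real k ^ m) + s ^ m \<le> real k * \<epsilon> * N" by simp
        moreover have "(D - (z * s / real m) ^ m) * s = real k * N - s ^ m - \<epsilon> * (s ^ k / real k ^ m)"
          unfolding left_diff_distrib zs using s by (simp add: D_def)
        ultimately show ?thesis by (simp add: algebra_simps)
      qed
      then have "n j * (real k * (1 - \<epsilon>) * N) \<le> n j * ((D - (z * s / real m) ^ m) * s)"
        by (intro mult_left_mono) (auto simp: n_def)
      ultimately have "(n j * (real k * (1 - \<epsilon>))) * N \<le> s * N" by (simp add: mult_ac)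
      then have "n j * (real k * (1 - \<epsilon>)) \<le> s" using \<open>N > 0\<close> by simp
      then show ?thesis using \<epsilon>1 k by (simp add: M_def pos_le_divide_eq)
    qed
    have "s / M = real k * (1 - \<epsilon>)" using s \<epsilon>1 k by (simp add: M_def)
    then have sM: "1 - (real k - s / M) = 1 - real k * \<epsilon>" by (simp add: right_diff_distrib)
    have prod_ge: "M ^ card J * (1 - real k * \<epsilon>) \<le> (\<Prod>l\<in>J. n l)" if "J \<subseteq> {..<k}" for J
    proof -
      have "0 \<le> n l \<and> n l \<le> M" if "l \<in> {..<k}" for l using that n_le by (simp add: n_def)
      from prod_ge_of_nearly_balanced[where x = n, OF _ \<open>J \<subseteq> {..<k}\<close> M this] show ?thesis
        by (simp add: n_sum sM)
    qed
    \<comment> \<open>Positivity is for the logarithms in \<open>power_diff_sum_ge_prod\<close>;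
      \<open>n_less\<close> below is for the induction hypothesis.\<close>
    have n_pos: "n j > 0" if "j < k" for j
    proof -
      have "0 < M * (1 - real k * \<epsilon>)" using M \<epsilon> by (intro mult_pos_pos) auto
      then show ?thesis using prod_ge[of "{j}"] that by simp
    qed
    have n_less: "n j < s" if "j < k" for j
    proof -
      have "real k * (1 - \<epsilon>) > 1" using \<epsilon> k by (simp add: algebra_simps)
      then have "M < s" using s by (simp add: M_def divide_less_eq mult.commute)
      then show ?thesis using n_le[OF that] by linarith
    qed
    \<comment> \<open>Using \<open>s / k\<close> in place of \<open>M\<close> lets the powers of
      \<open>s / k\<close> cancel in the double-counting inequality, leaving
      \<open>numeric_eps(2)\<close>.\<close>
    define \<tau> where "\<tau> = (s / real k) ^ (k - 2) * (1 - real k * \<epsilon>)"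
    have "card (copies k V b) \<le> (\<Prod>j<k. card (part j)) + (\<Sum>j<k. card (copies k (part j) b))"
    proof (rule card_copies_le_parts)
      show "\<tau> > 0" using s \<epsilon> k by (simp add: \<tau>_def)
      show "\<tau> \<le> (\<Prod>l\<in>{..<k} - {i, j}. real (card (part l)))" if "i < k" "j < k" "i \<noteq> j" for i j
      proof -
        have "card ({..<k} - {i, j}) = k - 2" using that by (simp add: card_Diff_subset)
        then have "M ^ (k - 2) * (1 - real k * \<epsilon>) \<le> (\<Prod>l\<in>{..<k} - {i, j}. n l)"
          using prod_ge[of "{..<k} - {i, j}"] by auto
        moreover have "s / real k \<le> M"
          using s \<epsilon> \<epsilon>1 k by (simp add: M_def field_simps)
        then have "\<tau> \<le> M ^ (k - 2) * (1 - real k * \<epsilon>)"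
          unfolding \<tau>_def using s \<epsilon> by (intro mult_right_mono power_mono) auto
        ultimately show ?thesis by (simp add: n_def)
      qed
      have "z * s / real (k - 2) = 26/(25 * real (k - 2)) * (s / real k)" by (simp add: z_def)
      then have "(z * s / real (k - 2)) ^ (k - 2) * (real k * real (k - 1))
          = (s / real k) ^ (k - 2) * ((26/(25 * real (k - 2))) ^ (k - 2) * (real k * real (k - 1)))"
        by (simp only: power_mult_distrib mult_ac)
      also have "\<dots> \<le> (s / real k) ^ (k - 2) * (2 * real (k - 2) * (1 - real k * \<epsilon>))"
        using numeric_eps(2)[OF k] s by (intro mult_left_mono) (auto simp: \<epsilon>_def)
      finally show "(z * s / real (k - 2)) ^ (k - 2) * (real k * real (k - 1)) \<le> 2 * real (k - 2) * \<tau>"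
        by (simp add: \<tau>_def mult_ac)
    qed
    then have "real (card (copies k V b))
        \<le> real ((\<Prod>j<k. card (part j)) + (\<Sum>j<k. card (copies k (part j) b)))"
      by (simp only: of_nat_le_iff)
    then have "N \<le> (\<Prod>j<k. n j) + (\<Sum>j<k. real (card (copies k (part j) b)))"
      by (simp add: N_def n_def)
    also have "(\<Sum>j<k. real (card (copies k (part j) b)))
        \<le> (\<Sum>j<k. n j ^ k / (real k ^ k - real k) + n j ^ m / (real k * \<epsilon>))"
    proof (intro sum_mono)
      fix j assume "j \<in> {..<k}"
      then have "card (part j) < card V" using n_less[of j] by (simp add: n_def s_def)
      from less.hyps[OF this finite_part]
      show "real (card (copies k (part j) b)) \<le> n j ^ k / (real k ^ k - real k) + n j ^ m / (real k * \<epsilon>)"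
        by (simp add: n_def m_def)
    qed
    also have "\<dots> = (\<Sum>j<k. n j ^ k) / (real k ^ k - real k) + (\<Sum>j<k. n j ^ m) / (real k * \<epsilon>)"
      by (simp add: sum.distrib sum_divide_distrib)
    finally have N_le: "N \<le> ((\<Prod>j<k. n j) + (\<Sum>j<k. n j ^ k) / (real k ^ k - real k))
        + (\<Sum>j<k. n j ^ m) / (real k * \<epsilon>)" by simp
    \<comment> \<open>The errors of the parts add up to at most the error allowed for
      \<open>s\<close>, so nothing accumulates in the induction.\<close>
    have "(\<Sum>j<k. n j ^ m) \<le> s ^ m"
      using sum_power_le_power_sum[of "{..<k}" n m] k n_sum by (simp add: n_def m_def)
    then have "(\<Sum>j<k. n j ^ m) / (real k * \<epsilon>) \<le> s ^ m / (real k * \<epsilon>)"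
      using \<epsilon> by (intro divide_right_mono) auto
    moreover have "(\<Prod>j<k. n j) + (\<Sum>j<k. n j ^ k) / (real k ^ k - real k) \<le> s ^ k / (real k ^ k - real k)"
    proof -
      have "(real k ^ k - real k) * (\<Prod>j<k. n j) + (\<Sum>j<k. n j ^ k) \<le> s ^ k"
        using power_diff_sum_ge_prod[of k n] n_pos n_sum k by simp
      then have "((real k ^ k - real k) * (\<Prod>j<k. n j) + (\<Sum>j<k. n j ^ k)) / (real k ^ k - real k)
          \<le> s ^ k / (real k ^ k - real k)"
        using kk0 by (intro divide_right_mono) auto
      then show ?thesis using kk0 by (simp add: add_divide_distrib)
    qed
    ultimately show False using N N_le by linarith
  qed
qed

section \<open>The iterated blow-up\<close>

text \<open>The last digit is the outermost level of the blow-up: its parts are the residue classes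
  mod \<open>k\<close>, nearly equal in size for every \<open>s\<close>.\<close>

function digit_role :: "nat \<Rightarrow> nat \<Rightarrow> nat \<Rightarrow> nat" where
  "digit_role k u v =
     (if k < 2 \<or> u = v \<or> u mod k \<noteq> v mod k then u mod k else digit_role k (u div k) (v div k))"
  by auto
termination
proof (relation "Wellfounded.measure (\<lambda>(k, u, v). u + v)")
  fix k u v :: nat
  assume "\<not> (k < 2 \<or> u = v \<or> u mod k \<noteq> v mod k)"
  then have "k \<ge> 2" "u \<noteq> v" by auto
  then have "u div k + v div k < u + v"
  proof (cases "u = 0")
    case True
    then show ?thesis using \<open>k \<ge> 2\<close> \<open>u \<noteq> v\<close> by simp
  next
    case False
    then show ?thesis using \<open>k \<ge> 2\<close> div_le_dividend[of v k] by (intro add_less_le_mono) auto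
  qed
  then show "((k, u div k, v div k), k, u, v) \<in> Wellfounded.measure (\<lambda>(k, u, v). u + v)" by simp
qed simp

declare digit_role.simps [simp del]

lemma digit_role_less: "k \<ge> 1 \<Longrightarrow> digit_role k u v < k"
proof (induction k u v rule: digit_role.induct)
  case (1 k u v)
  then show ?case by (subst digit_role.simps) auto
qed

lemma digit_role_asym: "k \<ge> 2 \<Longrightarrow> u \<noteq> v \<Longrightarrow> digit_role k u v \<noteq> digit_role k v u"
proof (induction k u v rule: digit_role.induct)
  case (1 k u v)
  show ?case
  proof (cases "u mod k = v mod k")
    case True
    then have "u div k \<noteq> v div k" using 1(3) by (metis mult_div_mod_eq)
    then show ?thesis using 1 True by (subst (1 2) digit_role.simps) auto
  next
    case False
    then show ?thesis by (subst (1 2) digit_role.simps) auto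
  qed
qed

lemma digit_role_differ:
  "i < k \<Longrightarrow> j < k \<Longrightarrow> i \<noteq> j \<Longrightarrow> digit_role k (k * x + i) (k * y + j) = i"
  by (subst digit_role.simps) simp

lemma digit_role_agree:
  "i < k \<Longrightarrow> 2 \<le> k \<Longrightarrow> x \<noteq> y \<Longrightarrow> digit_role k (k * x + i) (k * y + i) = digit_role k x y"
  by (subst digit_role.simps) simp

text \<open>\<open>E c g\<close> puts the digit \<open>c j\<close> behind \<open>g j\<close> at
  position \<open>j\<close>. For \<open>c = id\<close> the last digits differ, and every
  \<open>g\<close> gives a copy; for constant \<open>c\<close> they agree, and the copies are those
  given by \<open>g\<close> one level down.\<close>

lemma card_copies_digit_role_ge:
  assumes k: "k \<ge> 2"
  shows "(s div k) ^ k + k * card (copies k {..<s div k} (digit_role k))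
           \<le> card (copies k {..<s} (digit_role k))"
proof -
  define q where "q = s div k"
  define E where "E = (\<lambda>c g. \<lambda>j\<in>{..<k}. k * g j + c j :: nat)"
  define A where "A = ({..<k} \<rightarrow>\<^sub>E {..<q})"
  let ?C = "\<lambda>n. copies k {..<n} (digit_role k)"
  have card_A: "card A = q ^ k" by (simp add: A_def card_PiE)
  have CA: "?C q \<subseteq> A" by (auto simp: copies_def A_def)
  have digit: "E c g j mod k = c j" if "j < k" "c j < k" for c g j using that by (simp add: E_def)
  have less: "k * x + i < s" if "x < q" "i < k" for x i
  proof -
    have "k * x + i < k * Suc x" using that by simp
    also have "\<dots> \<le> k * q" using that by (intro mult_le_mono) auto
    also have "\<dots> \<le> s" by (simp add: q_def)
    finally show ?thesis .
  qed
  have inj: "inj_on (E c) A" for c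
  proof (intro inj_onI)
    fix f g assume fg: "f \<in> A" "g \<in> A" "E c f = E c g"
    have "f j = g j" if "j < k" for j
    proof -
      have "k * f j + c j = k * g j + c j"
        using fun_cong[OF fg(3), of j] that by (simp only: E_def restrict_apply' lessThan_iff)
      then show ?thesis using k by simp
    qed
    then show "f = g" using fg(1,2) unfolding A_def by (intro PiE_ext) auto
  qed
  have mem: "E c g \<in> {..<k} \<rightarrow>\<^sub>E {..<s}" if "g \<in> A" "\<And>j. j < k \<Longrightarrow> c j < k" for c g
    unfolding E_def restrict_PiE_iff
  proof
    fix j assume "j \<in> {..<k}"
    moreover from this have "g j \<in> {..<q}" using that(1) unfolding A_def by (rule PiE_mem[rotated])
    ultimately show "k * g j + c j \<in> {..<s}" using less[of "g j" "c j"] that(2)[of j] by simp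
  qed
  have T: "E id ` A \<subseteq> ?C s"
  proof
    fix f assume "f \<in> E id ` A"
    then obtain g where g: "g \<in> A" "f = E id g" by auto
    have "digit_role k (f i) (f j) = i" if "i < k" "j < k" "i \<noteq> j" for i j
      using digit_role_differ[OF that] that by (simp only: g(2) E_def restrict_apply' lessThan_iff id_apply)
    then show "f \<in> ?C s" using mem[OF g(1), of id] g by (simp add: copies_def)
  qed
  have I: "E (\<lambda>_. i) ` ?C q \<subseteq> ?C s" if "i < k" for i
  proof
    fix f assume "f \<in> E (\<lambda>_. i) ` ?C q"
    then obtain g where g: "g \<in> ?C q" "f = E (\<lambda>_. i) g" by auto
    have "digit_role k (f l) (f j) = l" if "l < k" "j < k" "l \<noteq> j" for l j
    proof -
      have "g l \<noteq> g j" using copies_inj[OF g(1)] that by blast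
      then have "digit_role k (k * g l + i) (k * g j + i) = digit_role k (g l) (g j)"
        by (rule digit_role_agree[OF \<open>i < k\<close> k])
      also have "\<dots> = l" by (rule copies_role[OF g(1) that])
      finally show ?thesis using that by (simp only: g(2) E_def restrict_apply' lessThan_iff)
    qed
    then show "f \<in> ?C s" using mem[of g "\<lambda>_. i"] g CA \<open>i < k\<close> by (auto simp: copies_def)
  qed
  have fin: "finite A" "finite (?C n)" for n by (auto simp: A_def finite_PiE finite_copies)
  have d1: "E id ` A \<inter> (\<Union>i<k. E (\<lambda>_. i) ` ?C q) = {}"
  proof (rule equals0I)
    fix f assume fA: "f \<in> E id ` A \<inter> (\<Union>i<k. E (\<lambda>_. i) ` ?C q)"
    then obtain g where "f = E id g" by blast
    moreover from fA obtain i g' where "i < k" "f = E (\<lambda>_. i) g'" by blast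
    ultimately have f: "f = E id g" "f = E (\<lambda>_. i) g'" "i < k" by blast+
    \<comment> \<open>The last digits at positions 0 and 1 differ in a transversal and agree in a
      copy inside one class.\<close>
    have "f 0 mod k = 0" "f 1 mod k = 1" using digit[of 0 id g] digit[of 1 id g] k f(1) by auto
    moreover have "f 0 mod k = i" "f 1 mod k = i"
      using digit[of 0 "\<lambda>_. i" g'] digit[of 1 "\<lambda>_. i" g'] k f(2,3) by auto
    ultimately show False by simp
  qed
  have d2: "E (\<lambda>_. i) ` ?C q \<inter> E (\<lambda>_. j) ` ?C q = {}" if "i < k" "j < k" "i \<noteq> j" for i j
  proof (rule equals0I)
    fix f assume fA: "f \<in> E (\<lambda>_. i) ` ?C q \<inter> E (\<lambda>_. j) ` ?C q"
    then obtain g where g: "f = E (\<lambda>_. i) g" by blast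
    from fA obtain g' where g': "f = E (\<lambda>_. j) g'" by blast
    have "f 0 mod k = i" using digit[of 0 "\<lambda>_. i" g] k that g by simp
    moreover have "f 0 mod k = j" using digit[of 0 "\<lambda>_. j" g'] k that g' by simp
    ultimately show False using that by simp
  qed
  have "q ^ k + k * card (?C q) = card (E id ` A) + (\<Sum>i<k. card (E (\<lambda>_. i) ` ?C q))"
    by (simp add: card_image[OF inj] card_image[OF inj_on_subset[OF inj CA]] card_A)
  also have "(\<Sum>i<k. card (E (\<lambda>_. i) ` ?C q)) = card (\<Union>i<k. E (\<lambda>_. i) ` ?C q)"
    by (rule card_UN_disjoint[symmetric]) (use fin d2 in simp_all)
  also have "card (E id ` A) + \<dots> = card (E id ` A \<union> (\<Union>i<k. E (\<lambda>_. i) ` ?C q))"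
    by (rule card_Un_disjoint[symmetric]) (use fin d1 in simp_all)
  also have "\<dots> \<le> card (?C s)" by (intro card_mono Un_least UN_least T I) (use fin in auto)
  finally show ?thesis by (simp add: q_def)
qed

theorem card_copies_digit_role_lower_bound:
  assumes k: "k \<ge> 4"
  shows "real s ^ k / (real k ^ k - real k) - real s ^ (k - 1)
           \<le> real (card (copies k {..<s} (digit_role k)))"
proof (induction s rule: less_induct)
  case (less s)
  define m where "m = k - 1"
  define K where "K = real k ^ k - real k"
  have m: "k = Suc m" "m \<ge> 3" using k by (auto simp: m_def)
  have "(4::real) ^ 2 \<le> real k ^ 2" using k by (intro power_mono) auto
  also have "\<dots> \<le> real k ^ (m - 1)" using k m by (intro power_increasing) auto
  finally have "16 * real k \<le> real k ^ (m - 1) * real k" by (intro mult_right_mono) auto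
  then have km: "16 * real k \<le> real k ^ m" using m power_minus_mult[of m "real k"] by simp
  have "real k ^ m \<le> real k ^ k" using k m by (intro power_increasing) auto
  then have K: "K \<ge> real k" "K > 0" using km k unfolding K_def by linarith+
  let ?N = "\<lambda>n. real (card (copies k {..<n} (digit_role k)))"
  show ?case
  proof (cases "s < k")
    case True
    \<comment> \<open>Here \<open>s < k \<le> K\<close>, so the left side of the claim is at most
      0.\<close>
    have "real s ^ k = real s * real s ^ m" by (simp add: m)
    also have "\<dots> \<le> K * real s ^ m" using True K by (intro mult_right_mono) auto
    finally have "real s ^ k / K \<le> real s ^ m" using K by (simp add: divide_le_eq mult.commute)
    then show ?thesis unfolding K_def[symmetric] m_def[symmetric]
      by (simp add: order_trans[of _ 0])
  next
    case False
    define q where "q = s div k"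
    define y where "y = real s / real k"
    have y: "y \<ge> 1" using False k by (simp add: y_def)
    have "q < s" using False k by (simp add: q_def)
    have "s mod k < k" using k by simp
    then have "s < k * q + k" using mult_div_mod_eq[of k s] unfolding q_def by linarith
    then have "real s < real k * (real q + 1)" by (simp add: distrib_left flip: of_nat_mult of_nat_add)
    then have "y < real q + 1" using k by (simp add: y_def divide_less_eq mult.commute)
    then have qy: "y - 1 \<le> real q" by linarith
    have yq: "real q \<le> y" unfolding q_def y_def by (rule of_nat_div_le_of_nat)
    have yk: "y ^ k = y * y ^ m" using m(1) by simp
    \<comment> \<open>Rounding \<open>y = s / k\<close> down to \<open>q\<close> costs at most
      \<open>k * y^m\<close>, by Bernoulli.\<close>
    have "y ^ k - real k * y ^ m = y ^ k * (1 + real k * (- 1 / y))"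
      unfolding yk using y by (simp add: field_simps)
    also have "\<dots> \<le> y ^ k * (1 + - 1 / y) ^ k"
      using y by (intro mult_left_mono Bernoulli_inequality) auto
    also have "\<dots> = (y - 1) ^ k"
    proof -
      have "y * (1 + - 1 / y) = y - 1" using y by (simp add: right_diff_distrib)
      then show ?thesis by (simp only: power_mult_distrib[symmetric])
    qed
    also have "\<dots> \<le> real q ^ k" using qy y by (intro power_mono) auto
    finally have qk: "y ^ k - real k * y ^ m \<le> real q ^ k" .
    have qm: "real q ^ m \<le> y ^ m" using yq by (intro power_mono) auto
    have sy: "real s = real k * y" using k by (simp add: y_def)
    \<comment> \<open>The density \<open>1/K\<close> is the fixed point of the recursion:
      \<open>k^k / K = 1 + k / K\<close>. The rounding loss is at most \<open>2*k*y^m\<close> and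
      the errors of the parts at most \<open>k*y^m\<close>; \<open>s^m = k^m * y^m\<close> covers
      both.\<close>
    have "real s ^ k / K = (1 + real k / K) * y ^ k"
    proof -
      have "real s ^ k = (K + real k) * y ^ k" by (simp add: sy power_mult_distrib K_def)
      then show ?thesis using K(2) by (simp add: distrib_right add_divide_distrib)
    qed
    moreover have "(1 + real k / K) * (real k * y ^ m) \<le> 2 * (real k * y ^ m)"
      using K y by (intro mult_right_mono) auto
    moreover have "3 * (real k * y ^ m) \<le> real s ^ m"
      using mult_right_mono[of "3 * real k" "real k ^ m" "y ^ m"] km y by (simp add: sy power_mult_distrib)
    ultimately have "real s ^ k / K - real s ^ m
        \<le> (1 + real k / K) * (y ^ k - real k * y ^ m) - real k * y ^ m"
      unfolding right_diff_distrib by linarith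
    also have "\<dots> \<le> (1 + real k / K) * real q ^ k - real k * real q ^ m"
      using qk qm K by (intro diff_mono mult_left_mono) auto
    also have "\<dots> = real q ^ k + real k * (real q ^ k / K - real q ^ m)"
      by (simp add: algebra_simps)
    also have "\<dots> \<le> real q ^ k + real k * ?N q"
      using less.IH[OF \<open>q < s\<close>] by (intro add_left_mono mult_left_mono) (auto simp: K_def m_def)
    also have "\<dots> = real (q ^ k + k * card (copies k {..<q} (digit_role k)))" by simp
    also have "\<dots> \<le> ?N s"
      unfolding q_def using card_copies_digit_role_ge[of k s] k by (simp only: of_nat_le_iff)
    finally show ?thesis by (simp add: K_def m_def)
  qed
qed

section \<open>Edge-coloured tournaments\<close>

lemma insert_two_subsets: "u \<in> A \<Longrightarrow> v \<in> A \<Longrightarrow> u \<noteq> v \<Longrightarrow> {u, v} \<in> two_subsets A"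
  by (simp add: two_subsets_def)

lemma two_subsetsE:
  assumes "e \<in> two_subsets A"
  obtains u v where "e = {u, v}" "u \<in> A" "v \<in> A" "u \<noteq> v"
  using assms by (auto simp: two_subsets_def card_2_iff)

text \<open>By injectivity of \<open>colR\<close> the colour of \<open>uv\<close> determines the
  pair \<open>{i, j}\<close>, and its direction tells which of the two \<open>u\<close> plays. So
  \<open>P u v\<close> holds for at most one role, and every copy is the image of a tuple.\<close>

lemma num_copies_le_card_copies:
  assumes R: "tournament k TR" and inj: "inj_on colR (two_subsets {0..<k})"
  shows "\<exists>a. num_copies k TR colR s T col \<le> card (copies k {..<s} a)"
proof -
  define P where "P = (\<lambda>u v i. \<exists>j. i < k \<and> j < k \<and> i \<noteq> j \<and> col {u, v} = colR {i, j} \<and> (T u v \<longleftrightarrow> TR i j))"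
  define a where "a = (\<lambda>u v. SOME i. P u v i)"
  have unique: "i = i'" if ii: "P u v i" "P u v i'" for u v i i'
  proof -
    obtain j where j: "i < k" "j < k" "i \<noteq> j" "col {u, v} = colR {i, j}" "T u v \<longleftrightarrow> TR i j"
      using ii(1) by (auto simp: P_def)
    obtain j' where j': "i' < k" "j' < k" "i' \<noteq> j'" "col {u, v} = colR {i', j'}" "T u v \<longleftrightarrow> TR i' j'"
      using ii(2) by (auto simp: P_def)
    have "{i, j} = {i', j'}"
      by (rule inj_onD[OF inj]) (use j j' in \<open>simp_all add: insert_two_subsets\<close>)
    moreover have "TR i j \<longleftrightarrow> \<not> TR j i" using R j(1-3) unfolding tournament_def by blast
    ultimately show "i = i'" using j(5) j'(5) by (auto simp: doubleton_eq_iff)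
  qed
  have "{K. K \<subseteq> {0..<s} \<and> card K = k \<and> is_copy k TR colR T col K} \<subseteq> (\<lambda>f. f ` {..<k}) ` copies k {..<s} a"
    (is "?L \<subseteq> _")
  proof
    fix K assume "K \<in> ?L"
    then obtain f where K: "K \<subseteq> {0..<s}" and f: "bij_betw f {0..<k} K"
      "\<And>i j. i < k \<Longrightarrow> j < k \<Longrightarrow> i \<noteq> j \<Longrightarrow> (T (f i) (f j) \<longleftrightarrow> TR i j) \<and> col {f i, f j} = colR {i, j}"
      by (auto simp: is_copy_def)
    define g where "g = restrict f {..<k}"
    have im: "f ` {..<k} = K" using f(1) by (simp add: bij_betw_def lessThan_atLeast0)
    have role: "a (g i) (g j) = i" if "i < k" "j < k" "i \<noteq> j" for i j
    proof -
      have "P (f i) (f j) i" unfolding P_def using f(2)[OF that] that by blast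
      then have "a (f i) (f j) = i" unfolding a_def using unique by (intro some_equality)
      then show ?thesis using that by (simp add: g_def)
    qed
    have "g \<in> {..<k} \<rightarrow>\<^sub>E {..<s}"
      unfolding g_def restrict_PiE_iff using im K by auto
    then have "g \<in> copies k {..<s} a" using role by (simp add: copies_def)
    moreover have "K = g ` {..<k}" using im by (simp add: g_def)
    ultimately show "K \<in> (\<lambda>f. f ` {..<k}) ` copies k {..<s} a" by blast
  qed
  then have "card ?L \<le> card (copies k {..<s} a)"
    by (rule surj_card_le[rotated]) (simp add: finite_copies)
  then show ?thesis unfolding num_copies_def by blast
qed

text \<open>Conversely, give each edge \<open>uv\<close> the colour and direction that
  \<open>R\<close> has between the roles \<open>a u v\<close> and \<open>a v u\<close>.\<close>

lemma card_copies_le_num_copies: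
  assumes R: "tournament k TR" and col: "colR ` two_subsets {0..<k} \<subseteq> two_subsets {1..k}"
    and k: "k \<ge> 2"
    and a: "\<And>u v. u \<noteq> v \<Longrightarrow> a u v < k" "\<And>u v. u \<noteq> v \<Longrightarrow> a u v \<noteq> a v u"
  shows "\<exists>T col. tournament s T \<and> edge_coloring k s col
           \<and> card (copies k {..<s} a) \<le> num_copies k TR colR s T col"
proof -
  define T where "T = (\<lambda>u v. u < s \<and> v < s \<and> u \<noteq> v \<and> TR (a u v) (a v u))"
  \<comment> \<open>\<open>Min\<close> and \<open>Max\<close> recover the two ends of an edge;
    exchanging them leaves the colour unchanged.\<close>
  define c where "c = (\<lambda>e. colR {a (Min e) (Max e), a (Max e) (Min e)})"
  have c: "c {u, v} = colR {a u v, a v u}" if "u \<noteq> v" for u v :: nat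
  proof (cases "u < v")
    case True
    then show ?thesis by (simp add: c_def)
  next
    case False
    with that have "v < u" by simp
    then show ?thesis by (simp add: c_def insert_commute)
  qed
  have "tournament s T"
  proof -
    have total: "TR i j \<or> TR j i" if "i < k" "j < k" "i \<noteq> j" for i j
      using R that unfolding tournament_def by blast
    have asym: "TR i j \<Longrightarrow> \<not> TR j i" for i j using R unfolding tournament_def by blast
    have "TR (a u v) (a v u) \<or> TR (a v u) (a u v)" if "u \<noteq> v" for u v
      by (rule total[OF a(1)[OF that] a(1)[OF that[symmetric]] a(2)[OF that]])
    then show ?thesis using asym by (simp add: tournament_def T_def)
  qed
  moreover have "edge_coloring k s c"
    unfolding edge_coloring_def
  proof
    fix e assume "e \<in> two_subsets {0..<s}"
    then obtain u v where e: "e = {u, v}" "u \<noteq> v" by (rule two_subsetsE)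
    have "{a u v, a v u} \<in> two_subsets {0..<k}"
      using a[OF e(2)] a(1)[of v u] e(2) by (intro insert_two_subsets) auto
    then show "c e \<in> two_subsets {1..k}" using col e c by auto
  qed
  moreover have "card (copies k {..<s} a) \<le> num_copies k TR colR s T c"
    unfolding num_copies_def
  proof (rule card_inj_on_le)
    show "inj_on (\<lambda>f. f ` {..<k}) (copies k {..<s} a)"
    proof (rule inj_onI)
      fix f g assume fg: "f \<in> copies k {..<s} a" "g \<in> copies k {..<s} a" "f ` {..<k} = g ` {..<k}"
      show "f = g"
      proof
        fix i
        show "f i = g i"
        proof (cases "i < k")
          case True
          \<comment> \<open>A second vertex of the copy already determines the position of
            \<open>f i\<close>, so equal images force equal tuples.\<close>
          obtain j where j: "j < k" "j \<noteq> i" using k that[of 0] that[of 1] by (cases "i = 0") auto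
          obtain p q where pq: "p < k" "q < k" "f i = g p" "f j = g q" using fg(3) True j(1) by blast
          then have "p \<noteq> q" using copies_inj[OF fg(1) True j(1)] j(2) by auto
          then have "p = i" using copies_role[OF fg(1) True j(1)] copies_role[OF fg(2) pq(1,2)] j(2) pq(3,4) by simp
          then show ?thesis using pq(3) by simp
        next
          case False
          then show ?thesis using copies_undefined[OF fg(1) False] copies_undefined[OF fg(2) False] by simp
        qed
      qed
    qed
    show "(\<lambda>f. f ` {..<k}) ` copies k {..<s} a \<subseteq> {K. K \<subseteq> {0..<s} \<and> card K = k \<and> is_copy k TR colR T c K}"
    proof (clarify, intro conjI)
      fix f assume f: "f \<in> copies k {..<s} a"
      have fs: "f i < s" if "i < k" for i using copies_mem[OF f that] by simp
      have inj: "inj_on f {..<k}" using copies_inj[OF f] by (auto intro: inj_onI)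
      show "f ` {..<k} \<subseteq> {0..<s}" using fs by auto
      show "card (f ` {..<k}) = k" by (simp add: card_image[OF inj])
      have "(T (f i) (f j) \<longleftrightarrow> TR i j) \<and> c {f i, f j} = colR {i, j}" if "i < k" "j < k" "i \<noteq> j" for i j
      proof -
        have ne: "f i \<noteq> f j" using copies_inj[OF f that(1,2)] that(3) by simp
        show ?thesis
          using c[OF ne] ne fs[OF that(1)] fs[OF that(2)] copies_role[OF f that]
            copies_role[OF f that(2,1)] that(3) by (simp add: T_def)
      qed
      moreover have "bij_betw f {0..<k} (f ` {..<k})"
        using inj by (simp add: bij_betw_def lessThan_atLeast0)
      ultimately show "is_copy k TR colR T c (f ` {..<k})" unfolding is_copy_def by blast
    qed
    show "finite {K. K \<subseteq> {0..<s} \<and> card K = k \<and> is_copy k TR colR T c K}"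
      by (rule finite_subset[of _ "Pow {0..<s}"]) auto
  qed
  ultimately show ?thesis by blast
qed

lemma max_copies_bounds:
  assumes k: "k \<ge> 4" and R: "tournament k TR"
    and col: "bij_betw colR (two_subsets {0..<k}) (two_subsets {1..k})"
  shows "real s ^ k / (real k ^ k - real k) - real s ^ (k - 1) \<le> real (max_copies k TR colR s)"
    and "real (max_copies k TR colR s) \<le> real s ^ k / (real k ^ k - real k)
           + real s ^ (k - 1) / (real k * (26/(25 * real (k - 1))) ^ (k - 1))"
proof -
  let ?S = "{num_copies k TR colR s T col | T col. tournament s T \<and> edge_coloring k s col}"
  \<comment> \<open>\<open>Max\<close> is meaningful only on a finite nonempty set; the blow-up
    below supplies an element.\<close>
  have "?S \<subseteq> {..2 ^ s}"
  proof
    fix x assume "x \<in> ?S"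
    then obtain T col where "x = num_copies k TR colR s T col" by blast
    then have "x \<le> card (Pow {0..<s})" unfolding num_copies_def by (auto intro!: card_mono)
    then show "x \<in> {..2 ^ s}" by (simp add: card_Pow)
  qed
  then have fin: "finite ?S" by (rule finite_subset) simp
  obtain T0 col0 where T0: "tournament s T0" "edge_coloring k s col0"
    "card (copies k {..<s} (digit_role k)) \<le> num_copies k TR colR s T0 col0"
    using card_copies_le_num_copies[OF R, of colR "digit_role k" s] col k digit_role_less[of k]
      digit_role_asym[of k] by (auto simp: bij_betw_def)
  then have mem: "num_copies k TR colR s T0 col0 \<in> ?S" by blast
  have "card (copies k {..<s} (digit_role k)) \<le> max_copies k TR colR s"
    unfolding max_copies_def using T0(3) Max_ge[OF fin mem] by linarith
  then have "real (card (copies k {..<s} (digit_role k))) \<le> real (max_copies k TR colR s)"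
    by simp
  then show "real s ^ k / (real k ^ k - real k) - real s ^ (k - 1) \<le> real (max_copies k TR colR s)"
    using card_copies_digit_role_lower_bound[OF k, of s] by linarith
  have "max_copies k TR colR s \<in> ?S"
    unfolding max_copies_def using mem by (intro Max_in[OF fin]) blast
  then obtain T col where "max_copies k TR colR s = num_copies k TR colR s T col" by blast
  then obtain a where "max_copies k TR colR s \<le> card (copies k {..<s} a)"
    using num_copies_le_card_copies[OF R bij_betw_imp_inj_on[OF col], of s T col] by metis
  then have "real (max_copies k TR colR s) \<le> real (card (copies k {..<s} a))" by simp
  then show "real (max_copies k TR colR s) \<le> real s ^ k / (real k ^ k - real k)
      + real s ^ (k - 1) / (real k * (26/(25 * real (k - 1))) ^ (k - 1))"
    using card_copies_upper_bound[OF k, of "{..<s}" a] by simp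
qed

section \<open>Passing to the limit\<close>

lemma tendsto_power_div_binomial:
  "(\<lambda>s. real s ^ k / real (s choose k)) \<longlonglongrightarrow> fact k"
proof -
  have "(\<lambda>s. (\<Prod>i<k. (real s - real i) / real s) / fact k) \<longlonglongrightarrow> (\<Prod>i<k. 1) / fact k"
  proof (intro tendsto_divide tendsto_prod tendsto_const)
    show "(\<lambda>s. (real s - real i) / real s) \<longlonglongrightarrow> 1" for i
      by real_asymp
  qed simp
  then have "(\<lambda>s. inverse ((\<Prod>i<k. (real s - real i) / real s) / fact k)) \<longlonglongrightarrow> inverse (1 / fact k)"
    by (intro tendsto_inverse) auto
  \<comment> \<open>For \<open>s < k\<close> both sides are 0: the factor with \<open>i = s\<close>
    vanishes, and so does the binomial coefficient.\<close>
  moreover have "inverse ((\<Prod>i<k. (real s - real i) / real s) / fact k) = real s ^ k / real (s choose k)" for s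
  proof -
    have "real (s choose k) = (\<Prod>i<k. real s - real i) / fact k"
      by (simp add: binomial_gbinomial gbinomial_prod_rev lessThan_atLeast0)
    then show ?thesis by (simp add: prod_dividef)
  qed
  ultimately show ?thesis by simp
qed

theorem theorem3p1:
  fixes k :: nat and TR :: "nat \<Rightarrow> nat \<Rightarrow> bool" and colR :: "nat set \<Rightarrow> nat set"
  assumes "k \<ge> 4"
    and "tournament k TR"
    and "bij_betw colR (two_subsets {0..<k}) (two_subsets {1..k})"
  shows "(\<lambda>s. real (max_copies k TR colR s) / real (s choose k))
           \<longlonglongrightarrow> fact k / (real k ^ k - real k)"
proof (rule tendsto_sandwich)
  let ?c = "\<lambda>s. real s ^ k / real (s choose k)"
  define C where "C = 1 / (real k * (26/(25 * real (k - 1))) ^ (k - 1))"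
  \<comment> \<open>The error terms become a convergent factor times \<open>1 / s\<close>, so both
    bounds have the same limit.\<close>
  have split: "real s ^ (k - 1) / real (s choose k) = ?c s * (1 / real s)" for s
  proof -
    have "real s ^ k = real s ^ (k - 1) * real s"
      using power_minus_mult[of k "real s"] assms(1) by simp
    then show ?thesis using assms(1) by (cases "s = 0") auto
  qed
  have "real k ^ 1 < real k ^ k" using assms(1) by (intro power_strict_increasing) auto
  then have ne: "real k ^ k - real k \<noteq> 0" by simp
  have lim: "(\<lambda>s. ?c s / (real k ^ k - real k) + D * (?c s * (1 / real s)))
      \<longlonglongrightarrow> fact k / (real k ^ k - real k) + D * (fact k * 0)" for D
    by (intro tendsto_intros tendsto_power_div_binomial lim_1_over_n ne)
  show "(\<lambda>s. ?c s / (real k ^ k - real k) + (-1) * (?c s * (1 / real s)))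
      \<longlonglongrightarrow> fact k / (real k ^ k - real k)"
    using lim[of "-1"] by simp
  show "(\<lambda>s. ?c s / (real k ^ k - real k) + C * (?c s * (1 / real s)))
      \<longlonglongrightarrow> fact k / (real k ^ k - real k)"
    using lim[of C] by simp
  show "\<forall>\<^sub>F s in sequentially. ?c s / (real k ^ k - real k) + (-1) * (?c s * (1 / real s))
      \<le> real (max_copies k TR colR s) / real (s choose k)"
  proof (rule always_eventually, rule allI)
    fix s
    from divide_right_mono[OF max_copies_bounds(1)[OF assms, of s], of "real (s choose k)"]
    show "?c s / (real k ^ k - real k) + (-1) * (?c s * (1 / real s))
        \<le> real (max_copies k TR colR s) / real (s choose k)"
      unfolding split[symmetric] by (simp add: diff_divide_distrib mult.commute)
  qed
  show "\<forall>\<^sub>F s in sequentially. real (max_copies k TR colR s) / real (s choose k)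
      \<le> ?c s / (real k ^ k - real k) + C * (?c s * (1 / real s))"
  proof (rule always_eventually, rule allI)
    fix s
    have "real (max_copies k TR colR s) \<le> real s ^ k / (real k ^ k - real k) + C * real s ^ (k - 1)"
      using max_copies_bounds(2)[OF assms, of s] by (simp add: C_def)
    from divide_right_mono[OF this, of "real (s choose k)"]
    show "real (max_copies k TR colR s) / real (s choose k)
        \<le> ?c s / (real k ^ k - real k) + C * (?c s * (1 / real s))"
      unfolding split[symmetric] by (simp add: add_divide_distrib mult.commute)
  qed
qed

end
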